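(* Let $n\ge2$ be any integer (prime or composite), $d\ge1$, $\alpha>1$, and positive weights $\boldsymbol\gamma=\{\gamma_u\}$ with $\gamma_\emptyset=1$. Let $\mathbf z\in\mathbb U_n^d$ be obtained by the CBC algorithm in the context, and take $M=\big(S_{n,d,\alpha,\boldsymbol\gamma}(\mathbf z)\big)^{-1/2}$ in the index set $\mathcal A_d(M)$. Then for every $\lambda\in(\frac1\alpha,1]$, the lattice approximation $A_n$ satisfies $$e^{\rm wor\text{-}app}_{n,d,M}(\mathbf z;L_2)\le\sqrt2\,[S_{n,d,\alpha,\boldsymbol\gamma}(\mathbf z)]^{1/4}\le\frac{\sqrt2\,\kappa^{1/(4\lambda)}}{\varphi(n)^{1/(4\lambda)}}\bigg(\sum_{u\subseteq\{1:d\}}\max(|u|,1)\,\gamma_u^\lambda[2\zeta(\alpha\lambda)]^{|u|}\bigg)^{1/(2\lambda)},$$ with $\kappa=2^{2\alpha\lambda+1}+1$; in particular the exponent of $\varphi(n)^{-1}$ can be taken arbitrarily close to $\alpha/4$. Moreover, the constant is independent of $d$ if, for $\delta>0$ (with $\lambda=1/(\alpha-4\delta)\in(\frac1\alpha,1]$), $$\sum_{u\subset\mathbb N,\ |u|<\infty}\gamma_u^{\frac{1}{\alpha-4\delta}}\Big[2\,e^{1/e}\,\zeta\big(\tfrac{\alpha}{\alpha-4\delta}\big)\Big]^{|u|}<\infty.$$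
   Context: Notation: $\{1:d\}=\{1,\ldots,d\}$; $\zeta$ is the Riemann zeta function. Weights $\gamma_u>0$ for finite $u\subset\mathbb N$, $\gamma_\emptyset=1$. For $\mathbf h\in\mathbb Z^d$, $\mathrm{supp}(\mathbf h)=\{j:h_j\ne0\}$, $r(\mathbf h)=r_{d,\alpha,\boldsymbol\gamma}(\mathbf h)=\gamma_{\mathrm{supp}(\mathbf h)}^{-1}\prod_{j\in\mathrm{supp}(\mathbf h)}|h_j|^\alpha$, and $r'(\mathbf h)=\prod_{j\in\mathrm{supp}(\mathbf h)}|h_j|^\alpha$. Weighted Korobov space $H_d$: one-periodic functions $f\in L_2([0,1]^d)$ with absolutely convergent Fourier series $f(\mathbf x)=\sum_{\mathbf h}\hat f(\mathbf h)e^{2\pi i\mathbf h\cdot\mathbf x}$, $\hat f(\mathbf h)=\int_{[0,1]^d}f(\mathbf x)e^{-2\pi i\mathbf h\cdot\mathbf x}d\mathbf x$, with norm $\|f\|^2_{d,\alpha,\boldsymbol\gamma}=\sum_{\mathbf h\in\mathbb Z^d}|\hat f(\mathbf h)|^2r(\mathbf h)$. $\mathbb U_n=\{z\in\mathbb Z:1\le z\le n-1,\gcd(z,n)=1\}$, $\varphi(n)=|\mathbb U_n|$. For $M>0$, $\mathcal A_d(M)=\{\mathbf h\in\mathbb Z^d:r(\mathbf h)\le M\}$. Lattice approximation with generating vector $\mathbf z$: $\mathbf t_k=\{k\mathbf z/n\}$ (componentwise fractional part), $k=1,\ldots,n$, $\hat f^a(\mathbf h)=\frac1n\sum_{k=1}^nf(\mathbf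 t_k)e^{-2\pi i\mathbf h\cdot\mathbf t_k}$, $A_n(f)(\mathbf x)=\sum_{\mathbf h\in\mathcal A_d(M)}\hat f^a(\mathbf h)e^{2\pi i\mathbf h\cdot\mathbf x}$. Worst-case error: $e^{\rm wor\text{-}app}_{n,d,M}(\mathbf z;L_q)=\sup_{\|f\|_{d,\alpha,\boldsymbol\gamma}\le1}\|f-A_n(f)\|_{L_q([0,1]^d)}$. $S_{n,d,\alpha,\boldsymbol\gamma}(\mathbf z)=\sum_{\mathbf h\in\mathbb Z^d}\frac{1}{r(\mathbf h)}\sum_{\boldsymbol\ell\in\mathbb Z^d\setminus\{\mathbf0\},\ \boldsymbol\ell\cdot\mathbf z\equiv0\ (\mathrm{mod}\ n)}\frac1{r(\mathbf h+\boldsymbol\ell)}$. For $s\ge1$ and $\{\beta_u\}_{u\subseteq\{1:s\}}$: $\theta_{n,s,\alpha}(z_1,\ldots,z_s;\{\beta_u\})=\sum_{\mathbf h\in\mathbb Z^s}\sum_{\boldsymbol\ell\in\mathbb Z^s,\ \ell_s\ne0,\ \boldsymbol\ell\cdot(z_1,\ldots,z_s)\equiv0\ (\mathrm{mod}\ n)}\frac{\beta_{\mathrm{supp}(\mathbf h)}}{r'(\mathbf h)}\frac{\beta_{\mathrm{supp}(\mathbf h+\boldsymbol\ell)}}{r'(\mathbf h+\boldsymbol\ell)}$, and $T_{n,d,s,\alpha,\boldsymbol\gamma}(z_1,\ldots,z_s)=\sum_{w\subseteq\{s+1,\ldots,d\}}[2\zeta(2\alpha)]^{|w|}\theta_{n,s,\alpha}(z_1,\ldots,z_s;\{\gamma_{u\cup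 w}\}_{u\subseteq\{1:s\}})$. CBC algorithm: for $s=1,\ldots,d$, with $z_1,\ldots,z_{s-1}$ fixed, choose $z_s\in\mathbb U_n$ minimizing $T_{n,d,s,\alpha,\boldsymbol\gamma}(z_1,\ldots,z_{s-1},z_s)$. *)

theory Defs
  imports "HOL-Analysis.Analysis" "HOL-Number_Theory.Number_Theory"
begin

definition zeta :: "real \<Rightarrow> real" where
  "zeta s = (\<Sum>k. 1 / (real (Suc k)) powr s)"

definition Zvec :: "nat \<Rightarrow> (nat \<Rightarrow> int) set" where
  "Zvec d = {h. \<forall>j. j \<notin> {1..d} \<longrightarrow> h j = 0}"

definition supp :: "(nat \<Rightarrow> int) \<Rightarrow> nat set" where
  "supp h = {j. h j \<noteq> 0}"

definition rprime :: "real \<Rightarrow> (nat \<Rightarrow> int) \<Rightarrow> real" where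
  "rprime \<alpha> h = (\<Prod>j\<in>supp h. \<bar>real_of_int (h j)\<bar> powr \<alpha>)"

definition rfun :: "real \<Rightarrow> (nat set \<Rightarrow> real) \<Rightarrow> (nat \<Rightarrow> int) \<Rightarrow> real" where
  "rfun \<alpha> \<gamma> h = rprime \<alpha> h / \<gamma> (supp h)"

definition unitsU :: "nat \<Rightarrow> nat set" where
  "unitsU n = {z. 1 \<le> z \<and> z \<le> n - 1 \<and> coprime z n}"

definition dual_cond :: "nat \<Rightarrow> nat \<Rightarrow> (nat \<Rightarrow> nat) \<Rightarrow> (nat \<Rightarrow> int) \<Rightarrow> bool" where
  "dual_cond n s z l \<longleftrightarrow> (\<Sum>j\<in>{1..s}. l j * int (z j)) mod int n = 0"

definition Sfun :: "nat \<Rightarrow> nat \<Rightarrow> real \<Rightarrow> (nat set \<Rightarrow> real) \<Rightarrow> (nat \<Rightarrow> nat) \<Rightarrow> real" where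
  "Sfun n d \<alpha> \<gamma> z =
     (\<Sum>\<^sub>\<infinity>h\<in>Zvec d. (1 / rfun \<alpha> \<gamma> h) *
        (\<Sum>\<^sub>\<infinity>l\<in>{l\<in>Zvec d. l \<noteq> (\<lambda>_. 0) \<and> dual_cond n d z l}. 1 / rfun \<alpha> \<gamma> (\<lambda>j. h j + l j)))"

definition theta :: "nat \<Rightarrow> nat \<Rightarrow> real \<Rightarrow> (nat \<Rightarrow> nat) \<Rightarrow> (nat set \<Rightarrow> real) \<Rightarrow> real" where
  "theta n s \<alpha> z \<beta> =
     (\<Sum>\<^sub>\<infinity>h\<in>Zvec s.
        (\<Sum>\<^sub>\<infinity>l\<in>{l\<in>Zvec s. l s \<noteq> 0 \<and> dual_cond n s z l}.
           (\<beta> (supp h) / rprime \<alpha> h) * (\<beta> (supp (\<lambda>j. h j + l j)) / rprime \<alpha> (\<lambda>j. h j + l j))))"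

definition Tfun :: "nat \<Rightarrow> nat \<Rightarrow> nat \<Rightarrow> real \<Rightarrow> (nat set \<Rightarrow> real) \<Rightarrow> (nat \<Rightarrow> nat) \<Rightarrow> real" where
  "Tfun n d s \<alpha> \<gamma> z =
     (\<Sum>w\<in>Pow {s+1..d}. (2 * zeta (2 * \<alpha>)) ^ card w * theta n s \<alpha> z (\<lambda>u. \<gamma> (u \<union> w)))"

definition is_CBC :: "nat \<Rightarrow> nat \<Rightarrow> real \<Rightarrow> (nat set \<Rightarrow> real) \<Rightarrow> (nat \<Rightarrow> nat) \<Rightarrow> bool" where
  "is_CBC n d \<alpha> \<gamma> z \<longleftrightarrow>
     (\<forall>s\<in>{1..d}. z s \<in> unitsU n \<and>
        (\<forall>z'\<in>unitsU n. Tfun n d s \<alpha> \<gamma> z \<le> Tfun n d s \<alpha> \<gamma> (z(s := z'))))"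

definition cube :: "nat \<Rightarrow> (nat \<Rightarrow> real) measure" where
  "cube d = PiM {1..d} (\<lambda>_. restrict_space lborel {0..1})"

definition dotp :: "nat \<Rightarrow> (nat \<Rightarrow> int) \<Rightarrow> (nat \<Rightarrow> real) \<Rightarrow> real" where
  "dotp d h x = (\<Sum>j\<in>{1..d}. real_of_int (h j) * x j)"

definition ebasis :: "nat \<Rightarrow> (nat \<Rightarrow> int) \<Rightarrow> (nat \<Rightarrow> real) \<Rightarrow> complex" where
  "ebasis d h x = exp (2 * pi * \<i> * complex_of_real (dotp d h x))"

definition fhat :: "nat \<Rightarrow> ((nat \<Rightarrow> real) \<Rightarrow> complex) \<Rightarrow> (nat \<Rightarrow> int) \<Rightarrow> complex" where
  "fhat d f h = (LINT x|cube d. f x * cnj (ebasis d h x))"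

definition korobov :: "nat \<Rightarrow> ((nat \<Rightarrow> real) \<Rightarrow> complex) set" where
  "korobov d = {f. f \<in> borel_measurable (cube d) \<and>
                   integrable (cube d) (\<lambda>x. (cmod (f x))\<^sup>2) \<and>
                   (\<lambda>h. cmod (fhat d f h)) summable_on Zvec d \<and>
                   (\<forall>x\<in>space (cube d). f x = (\<Sum>\<^sub>\<infinity>h\<in>Zvec d. fhat d f h * ebasis d h x))}"

definition korobov_ball :: "nat \<Rightarrow> real \<Rightarrow> (nat set \<Rightarrow> real) \<Rightarrow> ((nat \<Rightarrow> real) \<Rightarrow> complex) set" where
  "korobov_ball d \<alpha> \<gamma> = {f \<in> korobov d.
       (\<lambda>h. (cmod (fhat d f h))\<^sup>2 * rfun \<alpha> \<gamma> h) summable_on Zvec d \<and>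
       (\<Sum>\<^sub>\<infinity>h\<in>Zvec d. (cmod (fhat d f h))\<^sup>2 * rfun \<alpha> \<gamma> h) \<le> 1}"

definition L2norm :: "nat \<Rightarrow> ((nat \<Rightarrow> real) \<Rightarrow> complex) \<Rightarrow> real" where
  "L2norm d g = sqrt (LINT x|cube d. (cmod (g x))\<^sup>2)"

definition Aset :: "nat \<Rightarrow> real \<Rightarrow> (nat set \<Rightarrow> real) \<Rightarrow> real \<Rightarrow> (nat \<Rightarrow> int) set" where
  "Aset d \<alpha> \<gamma> M = {h\<in>Zvec d. rfun \<alpha> \<gamma> h \<le> M}"

definition lpt :: "nat \<Rightarrow> nat \<Rightarrow> (nat \<Rightarrow> nat) \<Rightarrow> nat \<Rightarrow> (nat \<Rightarrow> real)" where
  "lpt n d z k = restrict (\<lambda>j. frac (real k * real (z j) / real n)) {1..d}"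

definition fhat_a :: "nat \<Rightarrow> nat \<Rightarrow> (nat \<Rightarrow> nat) \<Rightarrow> ((nat \<Rightarrow> real) \<Rightarrow> complex) \<Rightarrow> (nat \<Rightarrow> int) \<Rightarrow> complex" where
  "fhat_a n d z f h = (1 / of_nat n) * (\<Sum>k\<in>{1..n}. f (lpt n d z k) * cnj (ebasis d h (lpt n d z k)))"

definition lattice_approx :: "nat \<Rightarrow> nat \<Rightarrow> real \<Rightarrow> (nat set \<Rightarrow> real) \<Rightarrow> real \<Rightarrow> (nat \<Rightarrow> nat)
      \<Rightarrow> ((nat \<Rightarrow> real) \<Rightarrow> complex) \<Rightarrow> (nat \<Rightarrow> real) \<Rightarrow> complex" where
  "lattice_approx n d \<alpha> \<gamma> M z f x = (\<Sum>h\<in>Aset d \<alpha> \<gamma> M. fhat_a n d z f h * ebasis d h x)"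

definition wce_app :: "nat \<Rightarrow> nat \<Rightarrow> real \<Rightarrow> (nat set \<Rightarrow> real) \<Rightarrow> real \<Rightarrow> (nat \<Rightarrow> nat) \<Rightarrow> real" where
  "wce_app n d \<alpha> \<gamma> M z =
     (SUP f\<in>korobov_ball d \<alpha> \<gamma>. L2norm d (\<lambda>x. f x - lattice_approx n d \<alpha> \<gamma> M z f x))"

definition err_const :: "nat \<Rightarrow> real \<Rightarrow> (nat set \<Rightarrow> real) \<Rightarrow> real \<Rightarrow> real" where
  "err_const d \<alpha> \<gamma> lam =
     sqrt 2 * (2 powr (2 * \<alpha> * lam + 1) + 1) powr (1 / (4 * lam)) *
     (\<Sum>u\<in>Pow {1..d}. real (max (card u) 1) * \<gamma> u powr lam * (2 * zeta (\<alpha> * lam)) ^ card u)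
        powr (1 / (2 * lam))"

end

theory Submission
  imports Defs
begin

text \<open>
  Error bound: by Parseval and aliasing, the squared \<open>L\<^sub>2\<close> error of a function in the unit ball is the
  truncation part, at most \<open>1 / M\<close>, plus the sum over \<open>h\<close> in the index set of
  \<open>\<bar>\<Sum>l. fhat (h + l)\<bar>\<^sup>2\<close>, where \<open>l\<close> runs over the nonzero dual lattice. Cauchy-Schwarz and
  \<open>1 \<le> M / r(h)\<close> bound the latter by \<open>M * S\<close>, and \<open>M = S powr (-1/2)\<close> balances the two parts.

  Bound on \<open>S\<close>: sorting the dual vectors by their last nonzero coordinate \<open>s\<close> gives \<open>S = (\<Sum>s. T s)\<close>.
  Subadditivity of \<open>x powr \<lambda>\<close> replaces \<open>\<alpha>\<close>, \<open>\<gamma>\<close> by \<open>a = \<alpha> * \<lambda>\<close>, \<open>\<gamma> powr \<lambda>\<close>, and the CBC choice makes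
  \<open>T s powr \<lambda>\<close> at most its mean over the units \<open>z\<^sub>s\<close>. At most \<open>g\<close> units solve \<open>l \<cdot> z \<equiv> 0 (mod n)\<close>, and
  none unless \<open>g\<close> divides \<open>l\<^sub>s\<close>, where \<open>g\<close> is the gcd of \<open>n\<close> and \<open>(\<Sum>j<s. l\<^sub>j z\<^sub>j)\<close>. Since \<open>g\<close> does not depend
  on \<open>l\<^sub>s\<close>, summing over the multiples \<open>l\<^sub>s\<close> of \<open>g\<close> gains \<open>g powr (- a)\<close>, which absorbs the count \<open>g\<close>, and what
  remains is a product sum over pairs \<open>(h, m)\<close> with \<open>h\<^sub>s \<noteq> 0\<close> or \<open>m\<^sub>s \<noteq> 0\<close>, with constant \<open>2 powr (a + 1)\<close>.
  Summing over \<open>s\<close> counts each pair at most \<open>\<bar>supp h\<bar> + \<bar>supp m\<bar> \<le> 2 max(\<bar>supp h\<bar>, 1) max(\<bar>supp m\<bar>, 1)\<close>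
  times, and \<open>2 powr (a + 2) \<le> 2 powr (2 * a + 1)\<close> because \<open>a > 1\<close>.
\<close>

section \<open>Weighted lattice sums\<close>

text \<open>The factor that one nonzero coordinate contributes to \<open>1 / rprime a h\<close>.
  Since \<open>0 powr x = 0\<close>, it vanishes at 0, so sums over nonzero integers can run over
  all integers; a zero coordinate, whose factor in \<open>rprime\<close> is 1, is treated
  separately.\<close>

definition inv_powr :: "real \<Rightarrow> int \<Rightarrow> real" where
  "inv_powr a k = \<bar>real_of_int k\<bar> powr (- a)"

lemma inv_powr_nonneg [simp]: "0 \<le> inv_powr a k" by (simp add: inv_powr_def)
lemma inv_powr_0 [simp]: "inv_powr a 0 = 0" by (simp add: inv_powr_def)
lemma inv_powr_minus [simp]: "inv_powr a (- k) = inv_powr a k" by (simp add: inv_powr_def)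

lemma zeta_has_sum:
  assumes "a > 1"
  shows "((\<lambda>k. 1 / real (Suc k) powr a) has_sum zeta a) UNIV"
proof -
  have "summable (\<lambda>k. real k powr (- a))"
    using assms by (subst summable_real_powr_iff) auto
  then have "summable (\<lambda>k. real (Suc k) powr (- a))"
    by (subst summable_Suc_iff)
  then have "summable (\<lambda>k. 1 / real (Suc k) powr a)"
    by (simp add: powr_minus_divide)
  then show ?thesis
    unfolding zeta_def by (intro sums_nonneg_imp_has_sum summable_sums) auto
qed

lemma zeta_ge_1:
  assumes "a > 1"
  shows "1 \<le> zeta a"
  using finite_sum_le_has_sum[OF zeta_has_sum[OF assms], of "{0}"] by simp

lemma inv_powr_has_sum:
  assumes "a > 1"
  shows "(inv_powr a has_sum 2 * zeta a) UNIV"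
proof -
  have 1: "(inv_powr a has_sum zeta a) (range (\<lambda>k. int (Suc k)))"
    using zeta_has_sum[OF assms]
    by (subst has_sum_reindex) (auto simp: inj_on_def inv_powr_def o_def powr_minus_divide)
  have 2: "(inv_powr a has_sum zeta a) (range (\<lambda>k. - int (Suc k)))"
    using zeta_has_sum[OF assms]
    by (subst has_sum_reindex) (auto simp: inj_on_def inv_powr_def o_def powr_minus_divide add.commute)
  have 3: "(inv_powr a has_sum (zeta a + zeta a)) (range (\<lambda>k. int (Suc k)) \<union> range (\<lambda>k. - int (Suc k)))"
    by (rule has_sum_Un_disjoint[OF 1 2]) auto
  have "k \<in> range (\<lambda>k. int (Suc k)) \<union> range (\<lambda>k. - int (Suc k))" if "k \<noteq> 0" for k
    using that by (cases k rule: int_cases2) (auto simp: image_iff gr0_conv_Suc)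
  then have "inv_powr a k = 0" if "k \<notin> range (\<lambda>k. int (Suc k)) \<union> range (\<lambda>k. - int (Suc k))" for k
    using that by (metis inv_powr_0)
  then have "(inv_powr a has_sum (zeta a + zeta a)) UNIV"
    using 3 by (subst has_sum_cong_neutral[where g = "inv_powr a" and T = "range (\<lambda>k. int (Suc k)) \<union> range (\<lambda>k. - int (Suc k))"]) auto
  then show ?thesis by simp
qed

text \<open>Rescaling by \<open>g\<close> produces the gain \<open>real g powr (- a)\<close> that
  later pays for the number of solutions of a congruence.\<close>

lemma inv_powr_multiples_has_sum:
  assumes "a > 1" "g > 0"
  shows "(inv_powr a has_sum (real g powr (- a) * (2 * zeta a))) {k. int g dvd k}"
proof -
  have "{k. int g dvd k} = range (\<lambda>k. int g * k)" by auto
  moreover have "inv_powr a (int g * k) = real g powr (- a) * inv_powr a k" for k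
    by (simp add: inv_powr_def abs_mult powr_mult)
  ultimately show ?thesis
    using has_sum_cmult_right[OF inv_powr_has_sum[OF assms(1)], of "real g powr (- a)"] assms(2)
    by (simp add: has_sum_reindex inj_on_def o_def)
qed

text \<open>As \<open>k\<close> is the difference of \<open>p + k\<close> and \<open>p\<close>, one
  of the two has absolute value at least \<open>\<bar>k\<bar> / 2\<close>. Its factor is at most
  \<open>2 powr a * inv_powr a k\<close>, while the other factor is kept; adding both outcomes
  covers either case. This separates the decay in \<open>k\<close> from the sum over
  \<open>p\<close>.\<close>

lemma inv_powr_mult_le:
  assumes "k \<noteq> 0" "a > 0"
  shows "inv_powr a p * inv_powr a (p + k) \<le> 2 powr a * inv_powr a k * (inv_powr a p + inv_powr a (p + k))"
proof (cases "p = 0 \<or> p + k = 0")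
  case True
  then show ?thesis by auto
next
  case False
  have *: "inv_powr a x \<le> 2 powr a * inv_powr a k" if "\<bar>k\<bar> \<le> 2 * \<bar>x\<bar>" for x
  proof -
    have "inv_powr a x \<le> (\<bar>real_of_int k\<bar> / 2) powr (- a)"
      unfolding inv_powr_def using that assms by (intro powr_mono2') auto
    also have "\<dots> = 2 powr a * inv_powr a k"
      by (simp add: inv_powr_def powr_divide powr_minus field_simps)
    finally show ?thesis .
  qed
  have "x \<le> 2 * y \<or> x \<le> 2 * w" if "x \<le> w + y" for x y w :: int
    using that by presburger
  moreover have "\<bar>k\<bar> \<le> \<bar>p + k\<bar> + \<bar>p\<bar>"
    using abs_triangle_ineq4[of "p + k" p] by simp
  ultimately have "\<bar>k\<bar> \<le> 2 * \<bar>p\<bar> \<or> \<bar>k\<bar> \<le> 2 * \<bar>p + k\<bar>" by blast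
  then show ?thesis
  proof
    assume "\<bar>k\<bar> \<le> 2 * \<bar>p\<bar>"
    then have "inv_powr a p * inv_powr a (p + k) \<le> 2 powr a * inv_powr a k * inv_powr a (p + k)"
      using * by (intro mult_right_mono) auto
    moreover have "0 \<le> 2 powr a * inv_powr a k * inv_powr a p" by simp
    ultimately show ?thesis by (simp only: distrib_left)
  next
    assume "\<bar>k\<bar> \<le> 2 * \<bar>p + k\<bar>"
    then have "inv_powr a (p + k) * inv_powr a p \<le> 2 powr a * inv_powr a k * inv_powr a p"
      using * by (intro mult_right_mono) auto
    moreover have "0 \<le> 2 powr a * inv_powr a k * inv_powr a (p + k)" by simp
    ultimately show ?thesis by (simp only: distrib_left mult.commute[of "inv_powr a p"])
  qed
qed

section \<open>Product weights and their sums over integer vectors\<close>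

lemma rprime_pos [simp]: "0 < rprime a h"
  unfolding rprime_def supp_def by (intro prod_pos) auto

lemma rprime_over_superset:
  assumes "finite J" "supp h \<subseteq> J"
  shows "rprime a h = (\<Prod>j\<in>J. if h j = 0 then 1 else \<bar>real_of_int (h j)\<bar> powr a)"
proof -
  have "rprime a h = (\<Prod>j\<in>supp h. if h j = 0 then 1 else \<bar>real_of_int (h j)\<bar> powr a)"
    unfolding rprime_def by (intro prod.cong) (auto simp: supp_def)
  also have "\<dots> = (\<Prod>j\<in>J. if h j = 0 then 1 else \<bar>real_of_int (h j)\<bar> powr a)"
    using assms by (intro prod.mono_neutral_left) (auto simp: supp_def)
  finally show ?thesis .
qed

lemma rprime_powr: "rprime a h powr t = rprime (a * t) h"
  unfolding rprime_def by (simp add: powr_powr prod_powr_distrib)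

lemma rprime_add_disjoint:
  assumes "finite (supp h)" "finite (supp k)" "supp h \<inter> supp k = {}"
  shows "rprime a (\<lambda>j. h j + k j) = rprime a h * rprime a k"
proof -
  let ?J = "supp h \<union> supp k"
  have *: "h j = 0 \<or> k j = 0" for j using assms(3) by (auto simp: supp_def)
  have "supp (\<lambda>j. h j + k j) \<subseteq> ?J" by (auto simp: supp_def)
  then have "rprime a (\<lambda>j. h j + k j) =
      (\<Prod>j\<in>?J. if h j + k j = 0 then 1 else \<bar>real_of_int (h j + k j)\<bar> powr a)"
    using assms(1,2) by (intro rprime_over_superset) auto
  also have "\<dots> = (\<Prod>j\<in>?J. (if h j = 0 then 1 else \<bar>real_of_int (h j)\<bar> powr a) *
      (if k j = 0 then 1 else \<bar>real_of_int (k j)\<bar> powr a))"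
  proof (intro prod.cong refl)
    fix j
    show "(if h j + k j = 0 then 1 else \<bar>real_of_int (h j + k j)\<bar> powr a) =
      (if h j = 0 then 1 else \<bar>real_of_int (h j)\<bar> powr a) * (if k j = 0 then 1 else \<bar>real_of_int (k j)\<bar> powr a)"
      using *[of j] by auto
  qed
  also have "\<dots> = rprime a h * rprime a k"
    using assms(1,2) by (simp add: prod.distrib rprime_over_superset[of ?J])
  finally show ?thesis .
qed

lemma supp_add_disjoint:
  assumes "supp h \<inter> supp k = {}"
  shows "supp (\<lambda>j. h j + k j) = supp h \<union> supp k"
proof -
  have *: "h j = 0 \<or> k j = 0" for j using assms by (auto simp: supp_def)
  have "h j + k j \<noteq> 0 \<longleftrightarrow> h j \<noteq> 0 \<or> k j \<noteq> 0" for j using *[of j] by auto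
  then show ?thesis by (auto simp: supp_def)
qed

text \<open>The reciprocal of \<open>rfun\<close>, with an arbitrary set function as weight. The
  proof uses it for \<open>\<gamma>\<close> itself, for its powers, for the shifted weights
  \<open>g (u \<union> w)\<close> and for weights multiplied by a cardinality.\<close>

definition inv_r :: "real \<Rightarrow> (nat set \<Rightarrow> real) \<Rightarrow> (nat \<Rightarrow> int) \<Rightarrow> real" where
  "inv_r a g h = g (supp h) / rprime a h"

lemma supp_upd: "h j = 0 \<Longrightarrow> supp (h(j := p)) = (if p = 0 then supp h else insert j (supp h))"
  by (auto simp: supp_def)

lemma inv_r_upd:
  assumes "finite (supp h)" "h j = 0"
  shows "inv_r a g (h(j := p)) =
    (if p = 0 then g (supp h) else g (insert j (supp h)) * inv_powr a p) / rprime a h"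
proof (cases "p = 0")
  case True
  then show ?thesis using assms by (simp add: inv_r_def fun_upd_idem)
next
  case False
  have "rprime a (h(j := p)) = rprime a h * \<bar>real_of_int p\<bar> powr a"
    using assms False unfolding rprime_def supp_upd[of h j p, OF assms(2)]
    by (auto simp: supp_def intro!: prod.cong)
  then show ?thesis
    using False assms by (simp add: inv_r_def supp_upd inv_powr_def powr_minus field_simps)
qed

text \<open>Summing out one coordinate stays inside the class \<open>inv_r\<close> and only changes
  the weight: the value 0 contributes \<open>g u\<close>, the nonzero values contribute
  \<open>g (insert j u)\<close> times \<open>2 * zeta a\<close>. This is the induction step for sums
  over whole vectors.\<close>

lemma inv_r_fibre_has_sum:
  assumes "a > 1" "finite (supp h)" "h j = 0"
  shows "((\<lambda>p. inv_r a g (h(j := p))) has_sum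
           inv_r a (\<lambda>u. g u + g (insert j u) * (2 * zeta a)) h) UNIV"
proof -
  have 1: "((\<lambda>p::int. if p = 0 then g (supp h) else 0) has_sum g (supp h)) UNIV"
    by (rule has_sum_finite_neutralI[where B = "{0}"]) auto
  have "((\<lambda>p. ((if p = 0 then g (supp h) else 0) + g (insert j (supp h)) * inv_powr a p) * (1 / rprime a h)) has_sum
     ((g (supp h) + g (insert j (supp h)) * (2 * zeta a)) * (1 / rprime a h))) UNIV"
    by (intro has_sum_cmult_left has_sum_add 1 has_sum_cmult_right inv_powr_has_sum assms)
  also have "?this = ?thesis"
    unfolding inv_r_upd[OF assms(2,3)]
    by (intro arg_cong2[where f = "\<lambda>f x. (f has_sum x) UNIV"]) (auto simp: inv_r_def)
  finally show ?thesis .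
qed

text \<open>Generalizes \<open>Zvec\<close> to any set of coordinates, because vectors supported
  above \<open>s\<close>, below \<open>s\<close> or away from \<open>s\<close> all occur.\<close>

definition vecs :: "nat set \<Rightarrow> (nat \<Rightarrow> int) set" where
  "vecs J = {h. supp h \<subseteq> J}"

lemma vecs_iff: "h \<in> vecs J \<longleftrightarrow> (\<forall>j. j \<notin> J \<longrightarrow> h j = 0)"
  by (auto simp: vecs_def supp_def)

lemma Zvec_eq_vecs: "Zvec d = vecs {1..d}"
  by (auto simp: Zvec_def vecs_def supp_def)

lemma finite_supp_vecs: "finite J \<Longrightarrow> h \<in> vecs J \<Longrightarrow> finite (supp h)"
  by (auto simp: vecs_def intro: finite_subset)

lemma inv_r_nonneg:
  assumes "finite J" "h \<in> vecs J" "\<And>u. finite u \<Longrightarrow> 0 \<le> g u"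
  shows "0 \<le> inv_r a g h"
  unfolding inv_r_def using assms(3)[OF finite_supp_vecs[OF assms(1,2)]]
  by (intro divide_nonneg_pos) auto

lemma bij_betw_vecs_insert:
  assumes "j \<notin> J"
  shows "bij_betw (\<lambda>(h, p). h(j := p)) (vecs J \<times> UNIV) (vecs (insert j J))"
  by (rule bij_betwI[where g = "\<lambda>h. (h(j := 0), h j)"])
     (use assms in \<open>auto simp: vecs_iff fun_eq_iff\<close>)

text \<open>Induction on \<open>J\<close> with the weight left general: a new coordinate is summed
  out first, and the induction hypothesis is applied to the modified weight. Nonnegativity justifies
  the iterated summation.\<close>

lemma inv_r_has_sum:
  assumes "a > 1" "finite J" "\<And>u. finite u \<Longrightarrow> 0 \<le> g u"
  shows "(inv_r a g has_sum (\<Sum>u\<in>Pow J. g u * (2 * zeta a) ^ card u)) (vecs J)"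
  using assms(2,3)
proof (induction J arbitrary: g rule: finite_induct)
  case empty
  have v: "vecs {} = {\<lambda>_. 0}" by (auto simp: vecs_def supp_def)
  have "inv_r a g (\<lambda>_. 0) = g {}" by (simp add: inv_r_def rprime_def supp_def)
  then have "(inv_r a g has_sum g {}) {\<lambda>_. 0}"
    using has_sum_finite[of "{\<lambda>_. 0}" "inv_r a g"] by simp
  then show ?case unfolding v by simp
next
  case (insert j J)
  let ?Z = "2 * zeta a"
  let ?g = "\<lambda>u. g u + g (insert j u) * ?Z"
  have Z: "?Z \<ge> 0" using zeta_ge_1[OF assms(1)] by simp
  have IH: "(inv_r a ?g has_sum (\<Sum>u\<in>Pow J. ?g u * ?Z ^ card u)) (vecs J)"
    using insert.prems Z by (intro insert.IH) auto
  have fib: "((\<lambda>p. inv_r a g (h(j := p))) has_sum inv_r a ?g h) UNIV" if "h \<in> vecs J" for h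
    using that insert.hyps assms(1)
    by (intro inv_r_fibre_has_sum) (auto simp: vecs_def supp_def intro: finite_subset)
  have nonneg: "0 \<le> inv_r a g (h(j := p))" if "h \<in> vecs J" for h p
    using that insert.hyps insert.prems
    by (intro inv_r_nonneg[of "insert j J"]) (auto simp: vecs_def supp_def)
  have "(\<lambda>(h, p). inv_r a g (h(j := p))) summable_on (vecs J \<times> UNIV)"
    by (rule summable_on_SigmaI[where g = "inv_r a ?g"])
       (use fib IH nonneg in \<open>auto simp: summable_on_def\<close>)
  then have "((\<lambda>(h, p). inv_r a g (h(j := p))) has_sum (\<Sum>u\<in>Pow J. ?g u * ?Z ^ card u)) (vecs J \<times> UNIV)"
    by (intro has_sum_SigmaI[OF _ IH]) (use fib in auto)
  then have "(inv_r a g has_sum (\<Sum>u\<in>Pow J. ?g u * ?Z ^ card u)) (vecs (insert j J))"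
    using has_sum_reindex_bij_betw[OF bij_betw_vecs_insert[OF insert.hyps(2)], of "inv_r a g"]
    by (simp add: case_prod_unfold)
  \<comment> \<open>The subsets of \<open>insert j J\<close> that contain \<open>j\<close> account
    for the second summand of \<open>?g\<close>, the extra factor \<open>?Z\<close> being the
    increase of the cardinality by one.\<close>
  also have "(\<Sum>u\<in>Pow J. ?g u * ?Z ^ card u) = (\<Sum>u\<in>Pow (insert j J). g u * ?Z ^ card u)"
  proof -
    have "(\<Sum>u\<in>insert j ` Pow J. g u * ?Z ^ card u) = (\<Sum>u\<in>Pow J. g (insert j u) * ?Z ^ card (insert j u))"
      using insert.hyps by (subst sum.reindex) (auto simp: inj_on_def)
    also have "\<dots> = (\<Sum>u\<in>Pow J. g (insert j u) * ?Z * ?Z ^ card u)"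
      using insert.hyps by (intro sum.cong refl, subst card_insert_disjoint) (auto intro: finite_subset)
    finally show ?thesis
      using insert.hyps unfolding Pow_insert
      by (subst sum.union_disjoint) (auto simp: sum.distrib distrib_right)
  qed
  finally show ?case .
qed

lemma has_sum_nonneg_mult_prod:
  fixes f :: "'a \<Rightarrow> real" and g :: "'b \<Rightarrow> real"
  assumes "(f has_sum x) A" "(g has_sum y) B"
    and "\<And>i. i \<in> A \<Longrightarrow> 0 \<le> f i" "\<And>j. j \<in> B \<Longrightarrow> 0 \<le> g j"
  shows "((\<lambda>(i, j). f i * g j) has_sum x * y) (A \<times> B)"
proof -
  have 1: "((\<lambda>j. f i * g j) has_sum f i * y) B" for i
    by (intro has_sum_cmult_right assms)
  have 2: "((\<lambda>i. f i * y) has_sum x * y) A"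
    by (intro has_sum_cmult_left assms)
  have "(\<lambda>(i, j). f i * g j) summable_on (A \<times> B)"
    by (rule summable_on_SigmaI[where g = "\<lambda>i. f i * y"])
       (use 1 2 assms in \<open>auto simp: summable_on_def\<close>)
  then show ?thesis by (intro has_sum_SigmaI[OF _ 2]) (use 1 in auto)
qed

lemma pair_inv_r_has_sum:
  assumes "a > 1" "finite J" "\<And>u. finite u \<Longrightarrow> 0 \<le> g u" "\<And>u. finite u \<Longrightarrow> 0 \<le> g' u"
  shows "((\<lambda>(h, m). inv_r a g h * inv_r a g' m) has_sum
    (\<Sum>u\<in>Pow J. g u * (2 * zeta a) ^ card u) * (\<Sum>u\<in>Pow J. g' u * (2 * zeta a) ^ card u))
    (vecs J \<times> vecs J)"
proof (rule has_sum_nonneg_mult_prod)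
  show "(inv_r a g has_sum (\<Sum>u\<in>Pow J. g u * (2 * zeta a) ^ card u)) (vecs J)"
    by (rule inv_r_has_sum[OF assms(1-3)])
  show "(inv_r a g' has_sum (\<Sum>u\<in>Pow J. g' u * (2 * zeta a) ^ card u)) (vecs J)"
    by (rule inv_r_has_sum[OF assms(1,2,4)])
qed (rule inv_r_nonneg[OF assms(2)]; use assms in blast)+

lemma pair_inv_r_summable:
  assumes "a > 1" "finite J" "\<And>u. finite u \<Longrightarrow> 0 \<le> g u" "\<And>u. finite u \<Longrightarrow> 0 \<le> g' u"
  shows "(\<lambda>(h, m). inv_r a g h * inv_r a g' m) summable_on (vecs J \<times> vecs J)"
  unfolding summable_on_def by (rule exI, rule pair_inv_r_has_sum[OF assms])

lemma vecs_add: "h \<in> vecs J \<Longrightarrow> l \<in> vecs J \<Longrightarrow> (\<lambda>j. h j + l j) \<in> vecs J"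
  by (simp add: vecs_iff)

lemma vecs_diff: "h \<in> vecs J \<Longrightarrow> l \<in> vecs J \<Longrightarrow> (\<lambda>j. h j - l j) \<in> vecs J"
  by (simp add: vecs_iff)

text \<open>The substitution \<open>m = h + l\<close> is a bijection on pairs, which reduces the
  correlation sum to a product of two convergent sums.\<close>

lemma shifted_pair_inv_r_summable:
  assumes "a > 1" "finite J" "\<And>u. finite u \<Longrightarrow> 0 \<le> g u"
  shows "(\<lambda>(h, l). inv_r a g h * inv_r a g (\<lambda>j. h j + l j)) summable_on (vecs J \<times> vecs J)"
proof -
  have "bij_betw (\<lambda>(h, l). (h, \<lambda>j. h j + l j)) (vecs J \<times> vecs J) (vecs J \<times> vecs J)"
    by (rule bij_betwI[where g = "\<lambda>(h, m). (h, \<lambda>j. m j - h j)"])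
       (use vecs_add vecs_diff in auto)
  from summable_on_reindex_bij_betw[OF this, of "\<lambda>(h, m). inv_r a g h * inv_r a g m"]
  show ?thesis
    using pair_inv_r_summable[OF assms(1,2) assms(3) assms(3)] by (simp add: case_prod_unfold)
qed

section \<open>Averaging over one component\<close>

lemma has_sum_finite_sum:
  fixes f :: "'a \<Rightarrow> 'b \<Rightarrow> 'c :: real_normed_vector"
  assumes "finite I" "\<And>i. i \<in> I \<Longrightarrow> (f i has_sum S i) A"
  shows "((\<lambda>x. \<Sum>i\<in>I. f i x) has_sum (\<Sum>i\<in>I. S i)) A"
  using assms by (induction I rule: finite_induct) (auto intro!: has_sum_add)

lemma infsum_finite_sum:
  fixes f :: "'a \<Rightarrow> 'b \<Rightarrow> 'c :: real_normed_vector"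
  assumes "finite I" "\<And>i. i \<in> I \<Longrightarrow> f i summable_on A"
  shows "infsum (\<lambda>x. \<Sum>i\<in>I. f i x) A = (\<Sum>i\<in>I. infsum (f i) A)"
  using assms by (intro infsumI has_sum_finite_sum has_sum_infsum) auto

text \<open>After division by \<open>x + y\<close> both terms lie in the unit interval, where
  \<open>u \<le> u powr t\<close>, and they add up to 1.\<close>

lemma powr_add_le_add_powr:
  fixes x y t :: real
  assumes "0 \<le> x" "0 \<le> y" "0 < t" "t \<le> 1"
  shows "(x + y) powr t \<le> x powr t + y powr t"
proof (cases "x + y = 0")
  case False
  have le: "u \<le> u powr t" if "0 \<le> u" "u \<le> 1" for u :: real
    using powr_mono'[of t 1 u] that assms by simp
  have "1 = x / (x + y) + y / (x + y)" using False by (simp flip: add_divide_distrib)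
  also have "\<dots> \<le> (x / (x + y)) powr t + (y / (x + y)) powr t"
    using assms False by (intro add_mono le) auto
  also have "\<dots> = (x powr t + y powr t) / (x + y) powr t"
    by (simp add: powr_divide add_divide_distrib)
  finally show ?thesis using False assms by (simp add: field_simps)
qed (use assms in simp)

lemma powr_sum_le_sum_powr:
  fixes f :: "'a \<Rightarrow> real"
  assumes "finite A" "\<And>x. x \<in> A \<Longrightarrow> 0 \<le> f x" "0 < t" "t \<le> 1"
  shows "(\<Sum>x\<in>A. f x) powr t \<le> (\<Sum>x\<in>A. f x powr t)"
  using assms(1,2)
proof (induction A rule: finite_induct)
  case (insert x A)
  have "(f x + (\<Sum>x\<in>A. f x)) powr t \<le> f x powr t + (\<Sum>x\<in>A. f x) powr t"
    using insert.prems assms by (intro powr_add_le_add_powr sum_nonneg) auto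
  also have "(\<Sum>x\<in>A. f x) powr t \<le> (\<Sum>x\<in>A. f x powr t)"
    using insert by auto
  finally show ?case using insert.hyps by simp
qed simp

lemma powr_infsum_le_infsum_powr:
  fixes f :: "'a \<Rightarrow> real"
  assumes "f summable_on A" "(\<lambda>x. f x powr t) summable_on A"
    and "\<And>x. x \<in> A \<Longrightarrow> 0 \<le> f x" "0 < t" "t \<le> 1"
  shows "(infsum f A) powr t \<le> infsum (\<lambda>x. f x powr t) A"
proof -
  let ?S = "infsum (\<lambda>x. f x powr t) A"
  \<comment> \<open>Moving the exponent to the right-hand side leaves a plain infinite sum on the
    left, for which it suffices to bound the finite partial sums.\<close>
  have "infsum f A \<le> ?S powr (1 / t)"
  proof (rule infsum_le_finite_sums[OF assms(1)])
    fix F assume F: "finite F" "F \<subseteq> A"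
    have "(\<Sum>x\<in>F. f x) powr t \<le> (\<Sum>x\<in>F. f x powr t)"
      using F assms by (intro powr_sum_le_sum_powr) auto
    also have "\<dots> \<le> ?S"
      using F assms by (intro finite_sum_le_infsum) auto
    finally have "((\<Sum>x\<in>F. f x) powr t) powr (1 / t) \<le> ?S powr (1 / t)"
      using assms by (intro powr_mono2) auto
    moreover have "0 \<le> (\<Sum>x\<in>F. f x)" using F assms by (intro sum_nonneg) auto
    ultimately show "(\<Sum>x\<in>F. f x) \<le> ?S powr (1 / t)"
      using assms by (simp add: powr_powr)
  qed
  then have "(infsum f A) powr t \<le> (?S powr (1 / t)) powr t"
    using assms by (intro powr_mono2 infsum_nonneg) auto
  also have "\<dots> = ?S"
    using assms by (simp add: powr_powr infsum_nonneg)
  finally show ?thesis .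
qed

text \<open>A solution forces \<open>gcd(k, n) = gcd(c, n) = g\<close>, and then \<open>z\<close> is determined modulo \<open>n / g\<close>.\<close>

lemma card_unit_solutions_le:
  fixes c k :: int and n :: nat
  assumes "n > 0"
  defines "g \<equiv> nat (gcd c (int n))"
  shows "card {z \<in> unitsU n. (c + k * int z) mod int n = 0} \<le> (if int g dvd k then g else 0)"
proof (cases "{z \<in> unitsU n. (c + k * int z) mod int n = 0} = {}")
  case False
  then obtain z0 where "z0 \<in> {z \<in> unitsU n. (c + k * int z) mod int n = 0}"
    unfolding ex_in_conv[symmetric] by (rule exE)
  then have z0: "coprime z0 n" "int n dvd c + k * int z0"
    by (simp_all only: unitsU_def mem_Collect_eq mod_0_imp_dvd)
  have g: "int g = gcd c (int n)" by (simp add: g_def)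
  have gpos: "g > 0" using assms by (simp add: g_def)
  have "int g dvd int n" "int g dvd c" by (simp_all add: g)
  then have "g dvd n" by simp
  have "int g dvd c + k * int z0" using \<open>int g dvd int n\<close> z0 dvd_trans by blast
  then have "int g dvd k * int z0" using \<open>int g dvd c\<close> by (simp add: dvd_add_right_iff)
  moreover have "coprime (int g) (int z0)"
    using z0(1) \<open>g dvd n\<close> by (metis coprime_commute coprime_divisors coprime_int_iff dvd_refl)
  ultimately have gk: "int g dvd k" by (simp add: coprime_dvd_mult_left_iff)
  define m where "m = n div g"
  have n: "n = m * g" using \<open>g dvd n\<close> by (simp add: m_def)
  have mpos: "m > 0" using n assms by (cases m) auto
  \<comment> \<open>This gcd divides \<open>n\<close>, hence \<open>c + k * int z0\<close>, and it
    divides \<open>k\<close>. Together with \<open>gk\<close> it makes both gcds equal to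
    \<open>g\<close>, so that \<open>k'\<close> is invertible modulo \<open>m\<close>.\<close>
  have "gcd k (int n) dvd c"
  proof -
    have "gcd k (int n) dvd c + k * int z0" using z0(2) dvd_trans by blast
    then show ?thesis by (meson dvd_add_left_iff dvd_mult2 gcd_dvd1)
  qed
  then have "gcd k (int n) dvd int g" by (simp add: g)
  then have gkn: "gcd k (int n) = int g"
    using gk \<open>int g dvd int n\<close> gpos by (intro zdvd_antisym_nonneg) auto
  obtain k' where k': "k = int g * k'" using gk by blast
  have "int g * gcd k' (int m) = int g * 1"
    using gkn gcd_mult_left[of "int g" k' "int m"] by (simp add: k' n mult.commute[of "int m"])
  then have cop: "coprime k' (int m)" using gpos by (simp add: coprime_iff_gcd_eq_1)
  have eqm: "z mod m = z' mod m"
    if "int n dvd c + k * int z" "int n dvd c + k * int z'" for z z'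
  proof -
    have "int n dvd k * (int z - int z')"
      using dvd_diff[OF that] by (simp add: algebra_simps)
    then have "int m dvd k' * (int z - int z')"
      using gpos by (simp add: n k' mult.assoc mult.commute)
    then have "int m dvd int z - int z'"
      using cop by (simp add: coprime_dvd_mult_right_iff coprime_commute)
    then show ?thesis by (metis mod_eq_dvd_iff of_nat_eq_iff zmod_int)
  qed
  \<comment> \<open>All solutions share one residue modulo \<open>m\<close>, so the quotient by
    \<open>m\<close> identifies a solution. Solutions lie below \<open>n = m * g\<close>, which
    leaves \<open>g\<close> possible quotients.\<close>
  have "inj_on (\<lambda>z. z div m) {z \<in> unitsU n. (c + k * int z) mod int n = 0}"
  proof (rule inj_onI)
    fix z z' assume z: "z \<in> {z \<in> unitsU n. (c + k * int z) mod int n = 0}"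
      "z' \<in> {z \<in> unitsU n. (c + k * int z) mod int n = 0}" and div: "z div m = z' div m"
    have "int n dvd c + k * int z" "int n dvd c + k * int z'"
      using z by (simp_all only: mem_Collect_eq mod_0_imp_dvd)
    then have "z mod m = z' mod m" by (rule eqm)
    with div show "z = z'" by (metis div_mult_mod_eq)
  qed
  moreover have "(\<lambda>z. z div m) ` {z \<in> unitsU n. (c + k * int z) mod int n = 0} \<subseteq> {..<g}"
    using assms(1) mpos
    by (auto simp: unitsU_def n less_mult_imp_div_less mult.commute)
  ultimately have "card {z \<in> unitsU n. (c + k * int z) mod int n = 0} \<le> card {..<g}"
    by (intro card_inj_on_le) auto
  then show ?thesis using gk by simp
next
  case True
  show ?thesis unfolding True by simp
qed

text \<open>Here \<open>w\<close> and \<open>w'\<close> are the sections of the weights of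
  \<open>h\<close> and \<open>h + l\<close> along coordinate \<open>s\<close>, \<open>k\<close> is
  the value of \<open>l\<close> there, and \<open>G k\<close> bounds the number of admissible units.
  The pair \<open>(0, 0)\<close> is missing on the right because \<open>k \<noteq> 0\<close>
  prevents \<open>p\<close> and \<open>p + k\<close> from both being 0.\<close>

lemma fibre_correlation_le:
  fixes a b0 b1 c0 c1 :: real and g :: nat
  assumes "a > 1" "g > 0" "b0 \<ge> 0" "b1 \<ge> 0" "c0 \<ge> 0" "c1 \<ge> 0"
  defines "w \<equiv> \<lambda>p. if p = 0 then b0 else b1 * inv_powr a p"
    and "w' \<equiv> \<lambda>p. if p = 0 then c0 else c1 * inv_powr a p"
    and "G \<equiv> \<lambda>k. if int g dvd k then real g else 0"
  shows "infsum (\<lambda>(k, p). w p * w' (p + k) * G k) ({k. k \<noteq> 0} \<times> UNIV)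
          \<le> 2 powr (a + 1) * infsum (\<lambda>(p, p'). w p * w' p') (- {(0, 0)})"
proof -
  define Z where "Z = 2 * zeta a"
  have Z: "Z \<ge> 1" using zeta_ge_1[OF assms(1)] by (simp add: Z_def)
  have inv_powr_Z: "(inv_powr a has_sum Z) UNIV" using inv_powr_has_sum[OF assms(1)] by (simp add: Z_def)
  have nonneg: "w p \<ge> 0" "w' p \<ge> 0" "G p \<ge> 0" for p
    using assms by (auto simp: w_def w'_def G_def)
  \<comment> \<open>A majorant with \<open>inv_powr a k\<close> factored out. Its three summands
    treat \<open>p = 0\<close>, \<open>p + k = 0\<close> and the case where neither vanishes; the
    last one comes from \<open>inv_powr_mult_le\<close>. The sum of the bracket over
    \<open>p\<close> is \<open>E\<close>.\<close>
  define D where "D = (\<lambda>k p. G k * inv_powr a k * ((if p = 0 then b0 * c1 else 0) +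
      (if p = - k then c0 * b1 else 0) + b1 * c1 * 2 powr a * (inv_powr a p + inv_powr a (p + k))))"
  define E where "E = b0 * c1 + c0 * b1 + b1 * c1 * 2 powr a * (Z + Z)"
  have Enn: "E \<ge> 0" using assms Z by (auto simp: E_def intro!: add_nonneg_nonneg mult_nonneg_nonneg)
  have point: "w p * w' (p + k) * G k \<le> D k p" if "k \<noteq> 0" for k p
  proof -
    have "w p * w' (p + k) \<le> inv_powr a k * ((if p = 0 then b0 * c1 else 0) +
      (if p = - k then c0 * b1 else 0) + b1 * c1 * 2 powr a * (inv_powr a p + inv_powr a (p + k)))"
    proof -
      consider "p = 0" | "p = - k" | "p \<noteq> 0" "p \<noteq> - k" by blast
      then show ?thesis
      proof cases
        case 1
        then show ?thesis using that assms by (simp add: w_def w'_def algebra_simps)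
      next
        case 2
        then show ?thesis using that assms by (simp add: w_def w'_def algebra_simps)
      next
        case 3
        then have "p + k \<noteq> 0" by arith
        then have "w p * w' (p + k) = b1 * c1 * (inv_powr a p * inv_powr a (p + k))"
          using 3 by (simp add: w_def w'_def)
        also have "\<dots> \<le> b1 * c1 * (2 powr a * inv_powr a k * (inv_powr a p + inv_powr a (p + k)))"
          using inv_powr_mult_le[OF that, of a p] assms by (intro mult_left_mono) auto
        finally show ?thesis using 3 by (simp add: algebra_simps)
      qed
    qed
    from mult_right_mono[OF this nonneg(3)[of k]] show ?thesis by (simp add: D_def algebra_simps)
  qed
  have sumD: "((\<lambda>p. D k p) has_sum (G k * inv_powr a k * E)) UNIV" for k
  proof -
    have shift: "((\<lambda>p. inv_powr a (p + k)) has_sum Z) UNIV"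
      using has_sum_reindex_bij_betw[of "\<lambda>p. p + k" UNIV UNIV "inv_powr a"] inv_powr_Z
      by (simp add: bij_plus_right)
    have d1: "((\<lambda>p::int. if p = 0 then b0 * c1 else 0) has_sum b0 * c1) UNIV"
      by (rule has_sum_finite_neutralI[where B = "{0}"]) auto
    have d2: "((\<lambda>p::int. if p = - k then c0 * b1 else 0) has_sum c0 * b1) UNIV"
      by (rule has_sum_finite_neutralI[where B = "{- k}"]) auto
    show ?thesis unfolding D_def E_def
      by (intro has_sum_cmult_right has_sum_add d1 d2 inv_powr_Z shift)
  qed
  \<comment> \<open>\<open>G\<close> vanishes off the multiples of \<open>g\<close> and
    \<open>inv_powr a\<close> vanishes at 0, so the nonzero integers may be exchanged for the
    multiples of \<open>g\<close>.\<close>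
  have sumk: "((\<lambda>k. G k * inv_powr a k * E) has_sum (real g * (real g powr (- a) * Z) * E)) {k. k \<noteq> 0}"
  proof -
    have "((\<lambda>k. real g * inv_powr a k * E) has_sum (real g * (real g powr (- a) * Z) * E)) {k. int g dvd k}"
      unfolding Z_def using assms by (intro has_sum_cmult_left has_sum_cmult_right inv_powr_multiples_has_sum) auto
    then show ?thesis
      by (subst has_sum_cong_neutral[where T = "{k. int g dvd k}" and g = "\<lambda>k. real g * inv_powr a k * E"])
         (auto simp: G_def)
  qed
  have D_nonneg: "D k p \<ge> 0" for k p
    unfolding D_def using assms(3-6) nonneg(3)
    by (intro mult_nonneg_nonneg add_nonneg_nonneg) simp_all
  have sumDD: "((\<lambda>(k, p). D k p) has_sum (real g * (real g powr (- a) * Z) * E)) ({k. k \<noteq> 0} \<times> UNIV)"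
  proof (rule has_sum_SigmaI[OF _ sumk])
    show "(\<lambda>(k, p). D k p) summable_on {k. k \<noteq> 0} \<times> UNIV"
      by (rule summable_on_SigmaI[where g = "\<lambda>k. G k * inv_powr a k * E"])
         (use sumD sumk D_nonneg in \<open>auto simp: summable_on_def\<close>)
  qed (use sumD in auto)
  have "infsum (\<lambda>(k, p). w p * w' (p + k) * G k) ({k. k \<noteq> 0} \<times> UNIV)
      \<le> infsum (\<lambda>(k, p). D k p) ({k. k \<noteq> 0} \<times> UNIV)"
  proof (rule infsum_mono)
    show "(\<lambda>(k, p). D k p) summable_on {k. k \<noteq> 0} \<times> UNIV"
      using sumDD by (rule has_sum_imp_summable)
    then show "(\<lambda>(k, p). w p * w' (p + k) * G k) summable_on {k. k \<noteq> 0} \<times> UNIV"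
      by (rule summable_on_comparison_test) (use point nonneg in auto)
  qed (use point in auto)
  also have "\<dots> = real g * (real g powr (- a) * Z) * E"
    using sumDD by (rule infsumI)
  \<comment> \<open>The count \<open>g\<close> times the gain \<open>real g powr (- a)\<close> is at
    most 1, since \<open>g \<ge> 1\<close> and \<open>a > 1\<close>.\<close>
  also have "\<dots> \<le> Z * E"
  proof -
    have "real g * real g powr (- a) = real g powr (1 - a)"
      using assms by (simp add: powr_diff powr_minus field_simps)
    also have "\<dots> \<le> 1"
      using assms powr_mono[of "1 - a" 0 "real g"] by simp
    finally have "(real g * real g powr (- a)) * (Z * E) \<le> 1 * (Z * E)"
      using Z Enn by (intro mult_right_mono) auto
    then show ?thesis by (simp add: mult.assoc)
  qed
  \<comment> \<open>The term with \<open>b1 * c1\<close> matches exactly, which dictates the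
    constant \<open>2 powr (a + 1)\<close>; the mixed terms have slack.\<close>
  also have "\<dots> \<le> 2 powr (a + 1) * ((b0 + b1 * Z) * (c0 + c1 * Z) - b0 * c0)"
  proof -
    have "2 powr (a + 1) * ((b0 + b1 * Z) * (c0 + c1 * Z) - b0 * c0) - Z * E
        = (2 powr (a + 1) - 1) * (Z * (b0 * c1 + c0 * b1))"
      by (simp add: E_def algebra_simps powr_add)
    moreover have "\<dots> \<ge> 0"
      using assms Z by (intro mult_nonneg_nonneg add_nonneg_nonneg) (auto simp: ge_one_powr_ge_zero)
    ultimately show ?thesis by linarith
  qed
  also have "(b0 + b1 * Z) * (c0 + c1 * Z) - b0 * c0 = infsum (\<lambda>(p, p'). w p * w' p') (- {(0, 0)})"
  proof -
    have b: "((\<lambda>p. (if p = 0 then b else 0) + b' * inv_powr a p) has_sum (b + b' * Z)) UNIV" for b b'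
    proof -
      have "((\<lambda>p::int. if p = 0 then b else 0) has_sum b) UNIV"
        by (rule has_sum_finite_neutralI[where B = "{0}"]) auto
      then show ?thesis by (intro has_sum_add has_sum_cmult_right inv_powr_Z)
    qed
    have "w = (\<lambda>p. (if p = 0 then b0 else 0) + b1 * inv_powr a p)"
      "w' = (\<lambda>p. (if p = 0 then c0 else 0) + c1 * inv_powr a p)"
      by (auto simp: w_def w'_def)
    then have "(w has_sum (b0 + b1 * Z)) UNIV" "(w' has_sum (c0 + c1 * Z)) UNIV"
      using b by auto
    then have 1: "((\<lambda>(p, p'). w p * w' p') has_sum ((b0 + b1 * Z) * (c0 + c1 * Z))) (UNIV \<times> UNIV)"
      using nonneg by (intro has_sum_nonneg_mult_prod) auto
    have 2: "((\<lambda>(p, p'). w p * w' p') has_sum (b0 * c0)) {(0, 0)}"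
      using has_sum_finite[of "{(0, 0)}" "\<lambda>(p, p'). w p * w' p'"] by (simp add: w_def w'_def)
    have "((\<lambda>(p, p'). w p * w' p') has_sum ((b0 + b1 * Z) * (c0 + c1 * Z) - b0 * c0)) (UNIV \<times> UNIV - {(0, 0)})"
      by (rule has_sum_Diff[OF 1 2]) auto
    then show ?thesis by (simp add: infsumI Compl_eq_Diff_UNIV)
  qed
  finally show ?thesis by simp
qed

section \<open>The dual lattice sums \<open>T\<close> and \<open>S\<close>\<close>

text \<open>The dual lattice vectors whose last nonzero coordinate is \<open>s\<close>.\<close>

definition dual_slice :: "nat \<Rightarrow> nat \<Rightarrow> (nat \<Rightarrow> nat) \<Rightarrow> (nat \<Rightarrow> int) set" where
  "dual_slice n s z = {l \<in> Zvec s. l s \<noteq> 0 \<and> dual_cond n s z l}"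

lemma Zvec_mono: "s \<le> d \<Longrightarrow> Zvec s \<subseteq> Zvec d"
  by (auto simp: Zvec_def)

lemma shifted_sum_summable:
  assumes "a > 1" "\<And>u. finite u \<Longrightarrow> 0 \<le> g u" "L \<subseteq> Zvec d"
  shows "(\<lambda>(h, l). inv_r a g h * inv_r a g (\<lambda>j. h j + l j)) summable_on (Zvec d \<times> L)"
  by (rule summable_on_subset_banach[OF shifted_pair_inv_r_summable[of a "{1..d}" g]])
     (use assms in \<open>auto simp: Zvec_eq_vecs\<close>)

lemma Zvec_add: "h \<in> Zvec d \<Longrightarrow> l \<in> Zvec d \<Longrightarrow> (\<lambda>j. h j + l j) \<in> Zvec d"
  unfolding Zvec_eq_vecs by (rule vecs_add)

lemma inv_r_nonneg_Zvec:
  assumes "\<And>u. finite u \<Longrightarrow> 0 \<le> g u" "h \<in> Zvec d"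
  shows "0 \<le> inv_r a g h"
  using inv_r_nonneg[of "{1..d}"] assms by (simp add: Zvec_eq_vecs)

lemma theta_eq_infsum:
  assumes "a > 1" "\<And>u. finite u \<Longrightarrow> 0 \<le> g u"
  shows "theta n s a z g =
    infsum (\<lambda>(h, l). inv_r a g h * inv_r a g (\<lambda>j. h j + l j)) (Zvec s \<times> dual_slice n s z)"
  unfolding theta_def dual_slice_def
  using infsum_Sigma'_banach[OF shifted_sum_summable[of a g "dual_slice n s z" s]] assms
  by (auto simp: dual_slice_def inv_r_def)

lemma inv_r_add_disjoint:
  assumes "finite (supp h)" "finite (supp k)" "supp h \<inter> supp k = {}"
  shows "inv_r a g (\<lambda>j. h j + k j) = inv_r a (\<lambda>u. g (u \<union> supp k)) h / rprime a k"
  using assms by (simp add: inv_r_def supp_add_disjoint rprime_add_disjoint)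

text \<open>Summing over the coordinates above \<open>s\<close>, which \<open>h\<close> and \<open>h + l\<close> share,
  produces the factor \<open>(2 * zeta (2 * a)) ^ card w\<close> in \<open>Tfun\<close>.\<close>

lemma Tfun_eq_infsum:
  assumes a: "a > 1" and g: "\<And>u. finite u \<Longrightarrow> 0 \<le> g u" and s: "s \<le> d"
  shows "Tfun n d s a g z =
    infsum (\<lambda>(h, l). inv_r a g h * inv_r a g (\<lambda>j. h j + l j)) (Zvec d \<times> dual_slice n s z)"
proof -
  let ?L = "dual_slice n s z"
  let ?W = "vecs {s+1..d}"
  define x where "x = (\<lambda>w (h, l). inv_r a (\<lambda>u. g (u \<union> w)) h * inv_r a (\<lambda>u. g (u \<union> w)) (\<lambda>j. h j + l j))"
  define F where "F = (\<lambda>(h, l). inv_r a g h * inv_r a g (\<lambda>j. h j + l j))"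
  \<comment> \<open>Splits the first vector into its coordinates up to \<open>s\<close> and those
    above; \<open>l\<close> has none above \<open>s\<close> and is left alone.\<close>
  define \<psi> where "\<psi> = (\<lambda>((h, l), k). ((\<lambda>j::nat. h j + k j :: int), l :: nat \<Rightarrow> int))"
  have L: "?L \<subseteq> Zvec s" "?L \<subseteq> Zvec d" using Zvec_mono[OF s] by (auto simp: dual_slice_def)
  have bij: "bij_betw \<psi> ((Zvec s \<times> ?L) \<times> ?W) (Zvec d \<times> ?L)"
  proof (rule bij_betwI[where g = "\<lambda>(h, l). (((\<lambda>j. if j \<le> s then h j else 0), l), (\<lambda>j. if j \<le> s then 0 else h j))"])
    show "\<psi> \<in> (Zvec s \<times> ?L) \<times> ?W \<rightarrow> Zvec d \<times> ?L"
      using s by (auto simp: \<psi>_def Zvec_def vecs_iff)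
  qed (use s in \<open>auto simp: \<psi>_def Zvec_def vecs_iff fun_eq_iff\<close>)
  have summF: "F summable_on Zvec d \<times> ?L"
    unfolding F_def using L a g by (intro shifted_sum_summable) auto
  have inner: "infsum (\<lambda>k. F (\<psi> (q, k))) ?W = (\<Sum>w\<in>Pow {s+1..d}. (2 * zeta (2 * a)) ^ card w * x w q)"
    if q: "q \<in> Zvec s \<times> ?L" for q
  proof -
    obtain h l where hl: "q = (h, l)" "h \<in> Zvec s" "l \<in> Zvec s" using q L by auto
    have fin: "finite (supp m)" "supp m \<subseteq> {1..s}" if "m \<in> Zvec s" for m
      using that by (auto simp: Zvec_eq_vecs vecs_def intro: finite_subset)
    \<comment> \<open>For fixed \<open>q\<close>, the number \<open>x w q\<close> plays the role of
      a weight on the support \<open>w\<close> of \<open>k\<close>. The factor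
      \<open>rprime a k\<close> occurs once for \<open>h\<close> and once for \<open>h + l\<close>,
      which doubles the exponent.\<close>
    have "F (\<psi> (q, k)) = inv_r (2 * a) (\<lambda>w. x w q) k" if k: "k \<in> ?W" for k
    proof -
      have fk: "finite (supp k)" "supp k \<subseteq> {s+1..d}" using k by (auto simp: vecs_def intro: finite_subset)
      have dis: "supp m \<inter> supp k = {}" if "m \<in> Zvec s" for m using fin(2)[OF that] fk(2) by fastforce
      have "(\<lambda>j. h j + k j + l j) = (\<lambda>j. (h j + l j) + k j)" by (simp add: fun_eq_iff)
      then have "F (\<psi> (q, k)) = inv_r a g (\<lambda>j. h j + k j) * inv_r a g (\<lambda>j. (h j + l j) + k j)"
        by (simp add: F_def \<psi>_def hl)
      also have "\<dots> = x (supp k) q / (rprime a k * rprime a k)"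
        using fin dis fk hl Zvec_add by (simp add: inv_r_add_disjoint x_def)
      also have "rprime a k * rprime a k = rprime (2 * a) k"
        using rprime_powr[of a k 2] by (simp add: power2_eq_square mult.commute less_imp_le)
      finally show ?thesis by (simp add: inv_r_def)
    qed
    then have "infsum (\<lambda>k. F (\<psi> (q, k))) ?W = infsum (inv_r (2 * a) (\<lambda>w. x w q)) ?W"
      by (intro infsum_cong) auto
    also have "\<dots> = (\<Sum>w\<in>Pow {s+1..d}. x w q * (2 * zeta (2 * a)) ^ card w)"
    proof (intro infsumI inv_r_has_sum)
      show "0 \<le> x w q" if "finite w" for w
      proof -
        have gw: "0 \<le> g (u \<union> w)" if "finite u" for u
          using that \<open>finite w\<close> by (intro g) simp
        show ?thesis
          unfolding x_def hl(1) prod.case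
          by (intro mult_nonneg_nonneg inv_r_nonneg_Zvec[where d = s] gw Zvec_add hl(2,3))
      qed
    qed (use a in auto)
    finally show ?thesis by (simp add: mult.commute)
  qed
  have summx: "x w summable_on Zvec s \<times> ?L" if "w \<in> Pow {s+1..d}" for w
    unfolding x_def using a L
  proof (intro shifted_sum_summable)
    show "0 \<le> g (u \<union> w)" if "finite u" for u
      using that \<open>w \<in> Pow {s+1..d}\<close> by (intro g) (auto intro: finite_subset)
  qed auto
  have "infsum F (Zvec d \<times> ?L) = infsum (\<lambda>q. F (\<psi> q)) ((Zvec s \<times> ?L) \<times> ?W)"
    by (rule infsum_reindex_bij_betw[OF bij, symmetric])
  also have "\<dots> = infsum (\<lambda>q. infsum (\<lambda>k. F (\<psi> (q, k))) ?W) (Zvec s \<times> ?L)"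
    using summF summable_on_reindex_bij_betw[OF bij, of F]
    by (intro infsum_Sigma_banach[symmetric]) auto
  also have "\<dots> = infsum (\<lambda>q. \<Sum>w\<in>Pow {s+1..d}. (2 * zeta (2 * a)) ^ card w * x w q) (Zvec s \<times> ?L)"
    using inner by (intro infsum_cong) auto
  also have "\<dots> = (\<Sum>w\<in>Pow {s+1..d}. infsum (\<lambda>q. (2 * zeta (2 * a)) ^ card w * x w q) (Zvec s \<times> ?L))"
    using summx by (intro infsum_finite_sum summable_on_cmult_right) auto
  also have "\<dots> = (\<Sum>w\<in>Pow {s+1..d}. (2 * zeta (2 * a)) ^ card w * infsum (x w) (Zvec s \<times> ?L))"
    by (simp add: infsum_cmult_right')
  also have "\<dots> = Tfun n d s a g z"
    unfolding Tfun_def x_def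
  proof (intro sum.cong refl arg_cong2[where f = "(*)"])
    fix w assume "w \<in> Pow {s+1..d}"
    then have w: "finite w" by (auto intro: finite_subset)
    show "infsum (\<lambda>(h, l). inv_r a (\<lambda>u. g (u \<union> w)) h * inv_r a (\<lambda>u. g (u \<union> w)) (\<lambda>j. h j + l j)) (Zvec s \<times> ?L)
      = theta n s a z (\<lambda>u. g (u \<union> w))"
      using w g by (intro theta_eq_infsum[OF a, symmetric]) auto
  qed
  finally show ?thesis by (simp add: F_def)
qed

section \<open>Splitting \<open>S\<close> by the last nonzero coordinate\<close>

definition dual_nonzero :: "nat \<Rightarrow> nat \<Rightarrow> (nat \<Rightarrow> nat) \<Rightarrow> (nat \<Rightarrow> int) set" where
  "dual_nonzero n d z = {l \<in> Zvec d. l \<noteq> (\<lambda>_. 0) \<and> dual_cond n d z l}"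

lemma dual_cond_restrict:
  assumes "l \<in> Zvec s" "s \<le> d"
  shows "dual_cond n d z l \<longleftrightarrow> dual_cond n s z l"
proof -
  have "(\<Sum>j\<in>{1..d}. l j * int (z j)) = (\<Sum>j\<in>{1..s}. l j * int (z j))"
    using assms by (intro sum.mono_neutral_right) (auto simp: Zvec_def)
  then show ?thesis by (simp add: dual_cond_def)
qed

lemma dual_nonzero_Suc:
  "dual_nonzero n (Suc d) z = dual_nonzero n d z \<union> dual_slice n (Suc d) z"
proof -
  have "l \<in> Zvec d \<longleftrightarrow> l \<in> Zvec (Suc d) \<and> l (Suc d) = 0" for l
    by (auto simp: Zvec_def) (metis le_SucE)
  then show ?thesis
    using dual_cond_restrict[of _ d "Suc d" n z]
    unfolding dual_nonzero_def dual_slice_def by fastforce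
qed

lemma inverse_rfun: "1 / rfun a g h = inv_r a g h"
  by (simp add: rfun_def inv_r_def)

lemma Sfun_summable:
  assumes "a > 1" "\<And>u. finite u \<Longrightarrow> 0 \<le> g u"
  shows "(\<lambda>(h, l). inv_r a g h * inv_r a g (\<lambda>j. h j + l j)) summable_on (Zvec d \<times> dual_nonzero n d z)"
  using assms by (intro shifted_sum_summable) (auto simp: dual_nonzero_def)

lemma Sfun_eq_infsum:
  assumes "a > 1" "\<And>u. finite u \<Longrightarrow> 0 \<le> g u"
  shows "Sfun n d a g z =
    infsum (\<lambda>(h, l). inv_r a g h * inv_r a g (\<lambda>j. h j + l j)) (Zvec d \<times> dual_nonzero n d z)"
proof -
  have "Sfun n d a g z = infsum (\<lambda>h. infsum (\<lambda>l. inv_r a g h * inv_r a g (\<lambda>j. h j + l j))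
      (dual_nonzero n d z)) (Zvec d)"
    unfolding Sfun_def dual_nonzero_def[symmetric] inverse_rfun infsum_cmult_right' by simp
  also have "\<dots> = infsum (\<lambda>(h, l). inv_r a g h * inv_r a g (\<lambda>j. h j + l j)) (Zvec d \<times> dual_nonzero n d z)"
    using assms by (intro infsum_Sigma'_banach Sfun_summable)
  finally show ?thesis .
qed

text \<open>Every nonzero dual vector has exactly one last nonzero coordinate, so the slices
  partition the nonzero dual lattice.\<close>

lemma Sfun_eq_sum_Tfun:
  assumes "a > 1" "\<And>u. finite u \<Longrightarrow> 0 \<le> g u"
  shows "Sfun n d a g z = (\<Sum>s\<in>{1..d}. Tfun n d s a g z)"
proof -
  let ?F = "\<lambda>(h, l). inv_r a g h * inv_r a g (\<lambda>j. h j + l j)"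
  \<comment> \<open>The induction runs over a separate bound \<open>t\<close> for \<open>l\<close>,
    because \<open>h\<close> has to range over all of \<open>Zvec d\<close> throughout.\<close>
  have "infsum ?F (Zvec d \<times> dual_nonzero n t z) = (\<Sum>s\<in>{1..t}. infsum ?F (Zvec d \<times> dual_slice n s z))"
    if "t \<le> d" for t
    using that
  proof (induction t)
    case 0
    have "dual_nonzero n 0 z = {}" by (auto simp: dual_nonzero_def Zvec_def)
    then show ?case by simp
  next
    case (Suc t)
    have *: "?F summable_on Zvec d \<times> dual_nonzero n t z" "?F summable_on Zvec d \<times> dual_slice n (Suc t) z"
      using Zvec_mono[of t d] Zvec_mono[of "Suc t" d] Suc.prems assms
      by (intro shifted_sum_summable; auto simp: dual_nonzero_def dual_slice_def)+
    have "infsum ?F (Zvec d \<times> dual_nonzero n (Suc t) z) =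
        infsum ?F (Zvec d \<times> dual_nonzero n t z \<union> Zvec d \<times> dual_slice n (Suc t) z)"
      by (simp only: dual_nonzero_Suc Sigma_Un_distrib2)
    also have "\<dots> = infsum ?F (Zvec d \<times> dual_nonzero n t z) + infsum ?F (Zvec d \<times> dual_slice n (Suc t) z)"
      by (intro infsum_Un_disjoint *) (auto simp: dual_nonzero_def dual_slice_def Zvec_def)
    finally show ?case using Suc by simp
  qed
  from this[of d] show ?thesis
    using assms by (simp add: Sfun_eq_infsum Tfun_eq_infsum)
qed

section \<open>Summing over all candidates for one component\<close>

lemma summable_on_infsum_sections:
  fixes f :: "'a \<times> 'b \<Rightarrow> real"
  assumes "f summable_on A \<times> B"
  shows "(\<lambda>x. infsum (\<lambda>y. f (x, y)) B) summable_on A"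
  using summable_on_Sigma_banach[of "\<lambda>x y. f (x, y)" A "\<lambda>_. B"] assms by simp

lemma finite_unitsU: "finite (unitsU n)"
  by (rule finite_subset[of _ "{..n}"]) (auto simp: unitsU_def)

lemma card_unitsU:
  assumes "n \<ge> 2"
  shows "card (unitsU n) = totient n"
proof -
  have "unitsU n = totatives n"
  proof (rule Set.set_eqI)
    fix k show "k \<in> unitsU n \<longleftrightarrow> k \<in> totatives n"
      using assms totatives_less[of k n] by (auto simp: unitsU_def in_totatives_iff)
  qed
  then show ?thesis by (simp add: totient_def)
qed

lemma dual_cond_upd:
  assumes "s \<ge> 1"
  shows "dual_cond n s (z(s := z')) l \<longleftrightarrow>
    ((\<Sum>j\<in>{1..<s}. l j * int (z j)) + l s * int z') mod int n = 0"
proof -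
  have "{1..s} = insert s {1..<s}" using assms by auto
  then have "(\<Sum>j\<in>{1..s}. l j * int ((z(s := z')) j)) = l s * int z' + (\<Sum>j\<in>{1..<s}. l j * int (z j))"
    by simp
  then show ?thesis by (simp add: dual_cond_def add.commute)
qed

text \<open>Averaging over the last component of the generating vector decouples \<open>h\<close> and \<open>h + l\<close>:
  the congruence on \<open>l\<close> disappears at the cost of a constant.\<close>

lemma sum_dual_slice_le:
  fixes a :: real and g :: "nat set \<Rightarrow> real"
  assumes n: "n > 0" and a: "a > 1" and g: "\<And>u. finite u \<Longrightarrow> 0 \<le> g u" and s: "1 \<le> s" "s \<le> d"
  defines "q \<equiv> inv_r a g"
  shows "(\<Sum>z'\<in>unitsU n. infsum (\<lambda>(h, l). q h * q (\<lambda>j. h j + l j)) (Zvec d \<times> dual_slice n s (z(s := z'))))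
    \<le> 2 powr (a + 1) * infsum (\<lambda>(h, m). q h * q m) {(h, m) \<in> Zvec d \<times> Zvec d. h s \<noteq> 0 \<or> m s \<noteq> 0}"
proof -
  let ?U = "unitsU n"
  let ?I = "Zvec d \<times> {l \<in> Zvec s. l s \<noteq> 0}"
  let ?A = "vecs ({1..d} - {s}) \<times> vecs {1..<s}"
  let ?B = "{k::int. k \<noteq> 0} \<times> (UNIV :: int set)"
  let ?E = "{(h, m) \<in> Zvec d \<times> Zvec d. h s \<noteq> 0 \<or> m s \<noteq> 0}"
  define q2 where "q2 = (\<lambda>(h, l). q h * q (\<lambda>j. h j + l j))"
  define c where "c = (\<lambda>l. \<Sum>j\<in>{1..<s}. l j * int (z j))"
  \<comment> \<open>The gcd of \<open>n\<close> with the part of the dot product below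
    \<open>s\<close>. It lies between 1 and \<open>n\<close> and is unaffected by the value of
    \<open>l\<close> at \<open>s\<close>.\<close>
  define e where "e = (\<lambda>l. nat (gcd (c l) (int n)))"
  define G where "G = (\<lambda>l k. if int (e l) dvd k then real (e l) else 0)"
  define K where "K = (2::real) powr (a + 1)"
  have epos: "e l > 0" for l using n by (simp add: e_def)
  have eq: "e l \<le> n" for l
    using n by (simp add: e_def nat_le_iff zdvd_imp_le)
  have Gle: "G l k \<le> real n" "0 \<le> G l k" for l k using eq by (auto simp: G_def)
  have summI: "q2 summable_on ?I"
    unfolding q2_def q_def using Zvec_mono[OF s(2)] a g by (intro shifted_sum_summable) auto
  have q2_nonneg: "0 \<le> q2 x" if "x \<in> ?I" for x
    using that Zvec_mono[OF s(2)] g Zvec_add[of "fst x" d "snd x"]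
    by (auto simp: q2_def q_def split: prod.splits intro!: mult_nonneg_nonneg inv_r_nonneg_Zvec[where d = d])
  have summb: "(\<lambda>x. q2 x * f x) summable_on ?I" if "\<And>x. 0 \<le> f x" "\<And>x. f x \<le> B" for f :: "_ \<Rightarrow> real" and B
    by (rule summable_on_comparison_test[OF summable_on_cmult_left[OF summI, of B]])
       (use that q2_nonneg in \<open>auto intro!: mult_left_mono\<close>)
  \<comment> \<open>Turning membership in the slice into an indicator gives all \<open>z'\<close>
    the same index set, so the finite sum can be moved inside and becomes a count of units.\<close>
  have "(\<Sum>z'\<in>?U. infsum q2 (Zvec d \<times> dual_slice n s (z(s := z')))) =
      (\<Sum>z'\<in>?U. infsum (\<lambda>x. q2 x * of_bool (dual_cond n s (z(s := z')) (snd x))) ?I)"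
    by (intro sum.cong refl infsum_cong_neutral) (auto simp: dual_slice_def)
  also have "\<dots> = infsum (\<lambda>x. \<Sum>z'\<in>?U. q2 x * of_bool (dual_cond n s (z(s := z')) (snd x))) ?I"
    by (intro infsum_finite_sum[symmetric] finite_unitsU summb[of _ 1]) auto
  also have "\<dots> \<le> infsum (\<lambda>x. q2 x * G (snd x) (snd x s)) ?I"
  proof (rule infsum_mono)
    show "(\<lambda>x. q2 x * G (snd x) (snd x s)) summable_on ?I"
      by (rule summb[of _ "real n"]) (use Gle in auto)
    show "(\<lambda>x. \<Sum>z'\<in>?U. q2 x * of_bool (dual_cond n s (z(s := z')) (snd x))) summable_on ?I"
      unfolding sum_distrib_left[symmetric]
    proof (rule summb[of _ "real (card ?U)"])
      show "(\<Sum>z'\<in>?U. of_bool (dual_cond n s (z(s := z')) (snd x))) \<le> real (card ?U)" for x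
        using sum_bounded_above[of ?U "\<lambda>z'. of_bool (dual_cond n s (z(s := z')) (snd x))" "1::real"] by simp
    qed (auto intro: sum_nonneg)
    fix x assume x: "x \<in> ?I"
    have "(\<Sum>z'\<in>?U. of_bool (dual_cond n s (z(s := z')) (snd x))) =
        real (card {z' \<in> ?U. (c (snd x) + snd x s * int z') mod int n = 0})"
      using finite_unitsU dual_cond_upd[OF s(1)] by (simp add: c_def sum_of_bool_eq Int_def)
    also have "\<dots> \<le> real (if int (e (snd x)) dvd snd x s then e (snd x) else 0)"
      unfolding e_def by (intro of_nat_mono card_unit_solutions_le[OF n])
    also have "\<dots> = G (snd x) (snd x s)" by (simp add: G_def)
    finally show "(\<Sum>z'\<in>?U. q2 x * of_bool (dual_cond n s (z(s := z')) (snd x))) \<le> q2 x * G (snd x) (snd x s)"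
      unfolding sum_distrib_left[symmetric] using q2_nonneg[OF x] by (intro mult_left_mono) auto
  qed
  also have "\<dots> \<le> K * infsum (\<lambda>(h, m). q h * q m) ?E"
  proof -
    define \<psi> :: "((nat \<Rightarrow> int) \<times> (nat \<Rightarrow> int)) \<times> int \<times> int \<Rightarrow> (nat \<Rightarrow> int) \<times> (nat \<Rightarrow> int)"
      where "\<psi> = (\<lambda>((h, l), (k, p)). (h(s := p), l(s := k)))"
    \<comment> \<open>Both maps start from \<open>h\<close> without its coordinate \<open>s\<close>
      and \<open>l\<close> below \<open>s\<close>. While \<open>\<psi>\<close> inserts the values of
      \<open>l\<close> and \<open>h\<close> at \<open>s\<close>, \<open>\<xi>\<close> inserts those
      of \<open>h\<close> and of \<open>h + l\<close>.\<close>
    define \<xi> :: "((nat \<Rightarrow> int) \<times> (nat \<Rightarrow> int)) \<times> int \<times> int \<Rightarrow> (nat \<Rightarrow> int) \<times> (nat \<Rightarrow> int)"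
      where "\<xi> = (\<lambda>((h, l), (p, p')). (h(s := p), (\<lambda>j. h j + l j)(s := p')))"
    have bij: "bij_betw \<psi> (?A \<times> ?B) ?I"
    proof (rule bij_betwI[where g = "\<lambda>(h, l). ((h(s := 0), l(s := 0)), (l s, h s))"])
      show "\<psi> \<in> ?A \<times> ?B \<rightarrow> ?I"
        using s by (auto simp: \<psi>_def Zvec_def vecs_iff)
      show "(\<lambda>(h, l). ((h(s := 0), l(s := 0)), (l s, h s))) \<in> ?I \<rightarrow> ?A \<times> ?B"
        using s by (auto simp: Zvec_def vecs_iff)
    qed (auto simp: \<psi>_def vecs_iff fun_eq_iff)
    let ?F = "\<lambda>x. q2 x * G (snd x) (snd x s)"
    let ?H = "\<lambda>(h, m). q h * q m"
    have summF: "?F summable_on ?I" by (rule summb[of _ "real n"]) (use Gle in auto)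
    have summF': "(\<lambda>x. ?F (\<psi> x)) summable_on ?A \<times> ?B"
      using summF summable_on_reindex_bij_betw[OF bij, of ?F] by simp
    have summE: "?H summable_on ?E"
      unfolding q_def
      by (rule summable_on_subset_banach[OF pair_inv_r_summable[of a "{1..d}" g g]])
         (use a g in \<open>auto simp: Zvec_eq_vecs\<close>)
    have inj: "inj_on \<xi> (?A \<times> - {(0, 0)})"
    proof (rule inj_on_inverseI[where g = "\<lambda>(h, m). ((h(s := 0), \<lambda>j. if j = s then 0 else m j - h j), (h s, m s))"])
    qed (auto simp: \<xi>_def vecs_iff fun_eq_iff)
    have sub: "\<xi> ` (?A \<times> - {(0, 0)}) \<subseteq> ?E"
      using s by (auto simp: \<xi>_def Zvec_def vecs_iff)
    have summH: "?H summable_on \<xi> ` (?A \<times> - {(0, 0)})"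
      by (rule summable_on_subset_banach[OF summE sub])
    then have summH': "(\<lambda>x. ?H (\<xi> x)) summable_on ?A \<times> - {(0, 0)}"
      using summable_on_reindex[OF inj, of ?H] by (simp add: o_def)
    have summH'': "(\<lambda>x. infsum (\<lambda>y. ?H (\<xi> (x, y))) (- {(0, 0)})) summable_on ?A"
      by (rule summable_on_infsum_sections[OF summH'])
    have fib: "infsum (\<lambda>y. ?F (\<psi> (x, y))) ?B \<le> K * infsum (\<lambda>y. ?H (\<xi> (x, y))) (- {(0, 0)})"
      if x: "x \<in> ?A" for x
    proof -
      obtain h l where hl: "x = (h, l)" "h \<in> vecs ({1..d} - {s})" "l \<in> vecs {1..<s}" using x by auto
      let ?m = "\<lambda>j. h j + l j"
      have hs: "h s = 0" "l s = 0" using hl by (auto simp: vecs_iff)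
      have m: "?m \<in> vecs ({1..d} - {s})" using hl s by (auto simp: vecs_iff)
      have fin: "finite (supp h)" "finite (supp ?m)"
        using finite_supp_vecs[OF _ hl(2)] finite_supp_vecs[OF _ m] by auto
      define b0 b1 c0 c1 where "b0 = g (supp h) / rprime a h" and "b1 = g (insert s (supp h)) / rprime a h"
        and "c0 = g (supp ?m) / rprime a ?m" and "c1 = g (insert s (supp ?m)) / rprime a ?m"
      have nn: "b0 \<ge> 0" "b1 \<ge> 0" "c0 \<ge> 0" "c1 \<ge> 0"
        unfolding b0_def b1_def c0_def c1_def using fin g
        by (intro divide_nonneg_pos; simp)+
      have qh: "q (h(s := p)) = (if p = 0 then b0 else b1 * inv_powr a p)" for p
        unfolding q_def using inv_r_upd[OF fin(1), of s a g p] hs by (simp add: b0_def b1_def)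
      have qm: "q (?m(s := p)) = (if p = 0 then c0 else c1 * inv_powr a p)" for p
        unfolding q_def using inv_r_upd[OF fin(2), of s a g p] hs by (simp add: c0_def c1_def)
      \<comment> \<open>On a fibre the gcd is therefore constant, and
        \<open>fibre_correlation_le\<close> applies with \<open>g = e l\<close>.\<close>
      have cl: "e (l(s := k)) = e l" for k
        by (simp add: e_def c_def)
      have upd: "(\<lambda>j. (h(s := p)) j + (l(s := k)) j) = ?m(s := p + k)" for p k
        by (auto simp: fun_eq_iff)
      have "(\<lambda>y. ?F (\<psi> (x, y))) = (\<lambda>(k, p). (if p = 0 then b0 else b1 * inv_powr a p) *
          (if p + k = 0 then c0 else c1 * inv_powr a (p + k)) * (if int (e l) dvd k then real (e l) else 0))"
      proof (rule ext)
        fix y :: "int \<times> int"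
        obtain k p where y: "y = (k, p)" by force
        have "?F (\<psi> (x, y)) = q (h(s := p)) * q (\<lambda>j. (h(s := p)) j + (l(s := k)) j) * G (l(s := k)) k"
          by (simp add: \<psi>_def hl(1) y q2_def del: fun_upd_apply)
             (simp add: fun_upd_same)
        then show "?F (\<psi> (x, y)) = (case y of (k, p) \<Rightarrow> (if p = 0 then b0 else b1 * inv_powr a p) *
          (if p + k = 0 then c0 else c1 * inv_powr a (p + k)) * (if int (e l) dvd k then real (e l) else 0))"
          unfolding upd qh qm by (simp add: y G_def cl)
      qed
      moreover have "(\<lambda>y. ?H (\<xi> (x, y))) = (\<lambda>(p, p'). (if p = 0 then b0 else b1 * inv_powr a p) *
          (if p' = 0 then c0 else c1 * inv_powr a p'))"
        by (auto simp: \<xi>_def hl(1) qh qm fun_eq_iff)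
      ultimately show ?thesis
        using fibre_correlation_le[OF a epos[of l] nn] by (simp add: K_def)
    qed
    have "infsum ?F ?I = infsum (\<lambda>x. ?F (\<psi> x)) (?A \<times> ?B)"
      by (rule infsum_reindex_bij_betw[OF bij, symmetric])
    also have "\<dots> = infsum (\<lambda>x. infsum (\<lambda>y. ?F (\<psi> (x, y))) ?B) ?A"
      by (rule infsum_Sigma_banach[OF summF', symmetric])
    also have "\<dots> \<le> infsum (\<lambda>x. K * infsum (\<lambda>y. ?H (\<xi> (x, y))) (- {(0, 0)})) ?A"
    proof (rule infsum_mono[OF _ _ fib])
      show "(\<lambda>x. infsum (\<lambda>y. ?F (\<psi> (x, y))) ?B) summable_on ?A"
        by (rule summable_on_infsum_sections[OF summF'])
      show "(\<lambda>x. K * infsum (\<lambda>y. ?H (\<xi> (x, y))) (- {(0, 0)})) summable_on ?A"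
        by (rule summable_on_cmult_right[OF summH''])
    qed
    also have "\<dots> = K * infsum (\<lambda>x. ?H (\<xi> x)) (?A \<times> - {(0, 0)})"
      by (simp only: infsum_cmult_right' infsum_Sigma_banach[OF summH'])
    also have "infsum (\<lambda>x. ?H (\<xi> x)) (?A \<times> - {(0, 0)}) = infsum ?H (\<xi> ` (?A \<times> - {(0, 0)}))"
      using infsum_reindex[OF inj, of ?H] by (simp add: o_def)
    \<comment> \<open>The image of \<open>\<xi>\<close> contains only pairs that agree above
      \<open>s\<close>; enlarging it to \<open>?E\<close> is harmless because all terms are
      nonnegative.\<close>
    also have "\<dots> \<le> infsum ?H ?E"
      using g by (intro infsum_mono2[OF summH summE sub])
        (auto simp: q_def intro!: mult_nonneg_nonneg inv_r_nonneg_Zvec[where d = d])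
    finally show ?thesis by (simp add: K_def mult_left_mono)
  qed
  finally show ?thesis by (simp add: q2_def K_def)
qed

section \<open>From the CBC choice to the bound on \<open>S\<close>\<close>

lemma inv_r_powr:
  "inv_r a g h powr t = inv_r (a * t) (\<lambda>u. g u powr t) h"
  by (simp add: inv_r_def powr_divide rprime_powr)

text \<open>After exchanging the sums, a pair \<open>(h, m)\<close> is counted once for each element
  of \<open>supp h \<union> supp m\<close>. The product bound on this count lets the cardinalities
  be absorbed into the weights, so the double sum factors into a square.\<close>

lemma sum_pair_inv_r_le:
  assumes a: "a > 1" and g: "\<And>u. finite u \<Longrightarrow> 0 \<le> g u"
  shows "(\<Sum>s\<in>{1..d}. infsum (\<lambda>(h, m). inv_r a g h * inv_r a g m)
            {(h, m) \<in> Zvec d \<times> Zvec d. h s \<noteq> 0 \<or> m s \<noteq> 0})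
    \<le> 2 * (\<Sum>u\<in>Pow {1..d}. real (max (card u) 1) * g u * (2 * zeta a) ^ card u)\<^sup>2"
proof -
  define H where "H = (\<lambda>(h, m). inv_r a g h * inv_r a g m)"
  define N where "N = (\<lambda>u::nat set. real (max (card u) 1))"
  let ?X = "Zvec d \<times> Zvec d"
  let ?P = "\<lambda>s x. fst x s \<noteq> (0::int) \<or> snd x s \<noteq> (0::int)"
  have summH: "H summable_on ?X"
    unfolding H_def Zvec_eq_vecs using a g by (intro pair_inv_r_summable) auto
  have H_nonneg: "0 \<le> H x" if "x \<in> ?X" for x
    using that g by (auto simp: H_def intro!: mult_nonneg_nonneg inv_r_nonneg_Zvec[where d = d])
  have summb: "(\<lambda>x. H x * of_bool (?P s x)) summable_on ?X" for s
    by (rule summable_on_comparison_test[OF summH]) (use H_nonneg in auto)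
  have "(\<Sum>s\<in>{1..d}. infsum H {(h, m) \<in> Zvec d \<times> Zvec d. h s \<noteq> 0 \<or> m s \<noteq> 0}) =
      (\<Sum>s\<in>{1..d}. infsum (\<lambda>x. H x * of_bool (?P s x)) ?X)"
    by (intro sum.cong refl infsum_cong_neutral) auto
  also have "\<dots> = infsum (\<lambda>x. \<Sum>s\<in>{1..d}. H x * of_bool (?P s x)) ?X"
    by (intro infsum_finite_sum[symmetric] summb) auto
  also have "\<dots> \<le> 2 * (\<Sum>u\<in>Pow {1..d}. N u * g u * (2 * zeta a) ^ card u)\<^sup>2"
  proof (rule has_sum_mono)
    show "((\<lambda>x. \<Sum>s\<in>{1..d}. H x * of_bool (?P s x)) has_sum
        infsum (\<lambda>x. \<Sum>s\<in>{1..d}. H x * of_bool (?P s x)) ?X) ?X"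
      by (rule has_sum_infsum, rule has_sum_imp_summable[OF has_sum_finite_sum[OF _ has_sum_infsum[OF summb]]]) simp
    let ?w = "inv_r a (\<lambda>u. N u * g u)"
    have "((\<lambda>(h, m). ?w h * ?w m) has_sum (\<Sum>u\<in>Pow {1..d}. N u * g u * (2 * zeta a) ^ card u) *
        (\<Sum>u\<in>Pow {1..d}. N u * g u * (2 * zeta a) ^ card u)) ?X"
      unfolding Zvec_eq_vecs using a g by (intro pair_inv_r_has_sum) (auto simp: N_def)
    then have "((\<lambda>x. 2 * (case x of (h, m) \<Rightarrow> ?w h * ?w m)) has_sum
        2 * ((\<Sum>u\<in>Pow {1..d}. N u * g u * (2 * zeta a) ^ card u) *
        (\<Sum>u\<in>Pow {1..d}. N u * g u * (2 * zeta a) ^ card u))) ?X"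
      by (rule has_sum_cmult_right)
    then show "((\<lambda>x. 2 * (case x of (h, m) \<Rightarrow> ?w h * ?w m)) has_sum
        2 * (\<Sum>u\<in>Pow {1..d}. N u * g u * (2 * zeta a) ^ card u)\<^sup>2) ?X"
      by (simp add: power2_eq_square)
    fix x assume x: "x \<in> ?X"
    obtain h m where hm: "x = (h, m)" "h \<in> Zvec d" "m \<in> Zvec d" using x by auto
    have fin: "finite (supp h)" "finite (supp m)"
      using hm finite_supp_vecs[of "{1..d}"] by (auto simp: Zvec_eq_vecs)
    have "(\<Sum>s\<in>{1..d}. of_bool (?P s x)) = real (card ({1..d} \<inter> {s. ?P s x}))"
      by (simp add: sum_of_bool_eq)
    also have "\<dots> \<le> real (card (supp h \<union> supp m))"
      using fin by (intro of_nat_mono card_mono) (auto simp: hm supp_def)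
    also have "\<dots> \<le> real (card (supp h) + card (supp m))"
      by (intro of_nat_mono card_Un_le)
    also have "\<dots> \<le> 2 * (N (supp h) * N (supp m))"
    proof -
      have "card (supp h) + card (supp m) \<le> max (card (supp h)) 1 + max (card (supp m)) 1" by simp
      also have "\<dots> \<le> 2 * (max (card (supp h)) 1 * max (card (supp m)) 1)"
      proof -
        \<comment> \<open>Each summand is at most the product, as both are at least 1; this is why
          the empty support is counted as 1.\<close>
        have "x + y \<le> 2 * (x * y)" if "x \<ge> 1" "y \<ge> 1" for x y :: nat
        proof -
          have "x * 1 \<le> x * y" "1 * y \<le> x * y" using that by (intro mult_le_mono order_refl; simp)+
          then show ?thesis by linarith
        qed
        then show ?thesis by simp
      qed
      finally show ?thesis unfolding N_def by (metis (mono_tags) of_nat_le_iff of_nat_mult of_nat_numeral)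
    qed
    finally have "H x * (\<Sum>s\<in>{1..d}. of_bool (?P s x)) \<le> H x * (2 * (N (supp h) * N (supp m)))"
      using H_nonneg[OF x] by (intro mult_left_mono)
    also have "\<dots> = 2 * (case x of (h, m) \<Rightarrow> ?w h * ?w m)"
      by (simp add: H_def hm inv_r_def)
    finally show "(\<Sum>s\<in>{1..d}. H x * of_bool (?P s x)) \<le> 2 * (case x of (h, m) \<Rightarrow> ?w h * ?w m)"
      by (simp only: sum_distrib_left)
  qed
  finally show ?thesis by (simp add: H_def N_def)
qed

lemma Tfun_nonneg:
  assumes "a > 1" "\<And>u. finite u \<Longrightarrow> 0 \<le> g u" "s \<le> d"
  shows "0 \<le> Tfun n d s a g z"
  using assms Zvec_mono[OF assms(3)] Zvec_add
  by (auto simp: Tfun_eq_infsum dual_slice_def subset_iff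
      intro!: infsum_nonneg mult_nonneg_nonneg inv_r_nonneg_Zvec[where d = d])

text \<open>Subadditivity is applied to the flattened form of \<open>Tfun\<close>, a single sum over
  pairs. Powers of its terms are again of the form \<open>inv_r\<close>, with exponent
  \<open>a * t\<close>, and \<open>a * t > 1\<close> keeps the new sum convergent.\<close>

lemma Tfun_powr_le:
  assumes a: "a > 1" "a * t > 1" and t: "0 < t" "t \<le> 1"
    and g: "\<And>u. finite u \<Longrightarrow> 0 \<le> g u" and s: "s \<le> d"
  defines "q \<equiv> inv_r (a * t) (\<lambda>u. g u powr t)"
  shows "Tfun n d s a g z powr t \<le>
    infsum (\<lambda>(h, l). q h * q (\<lambda>j. h j + l j)) (Zvec d \<times> dual_slice n s z)"
proof -
  let ?F = "\<lambda>(h, l). inv_r a g h * inv_r a g (\<lambda>j. h j + l j)"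
  have L: "dual_slice n s z \<subseteq> Zvec d"
    using Zvec_mono[OF s] by (auto simp: dual_slice_def)
  have F: "(\<lambda>x. ?F x powr t) = (\<lambda>(h, l). q h * q (\<lambda>j. h j + l j))"
    by (auto simp: q_def powr_mult inv_r_powr)
  have "infsum ?F (Zvec d \<times> dual_slice n s z) powr t \<le>
      infsum (\<lambda>x. ?F x powr t) (Zvec d \<times> dual_slice n s z)"
  proof (rule powr_infsum_le_infsum_powr[OF _ _ _ t])
    show "?F summable_on Zvec d \<times> dual_slice n s z"
      using a g L by (intro shifted_sum_summable) auto
    show "(\<lambda>x. ?F x powr t) summable_on Zvec d \<times> dual_slice n s z"
      unfolding F unfolding q_def using a L by (intro shifted_sum_summable) auto
    show "0 \<le> ?F x" if "x \<in> Zvec d \<times> dual_slice n s z" for x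
      using that g L Zvec_add
      by (auto intro!: mult_nonneg_nonneg inv_r_nonneg_Zvec[where d = d])
  qed
  then show ?thesis using a g s by (simp add: F Tfun_eq_infsum)
qed

lemma Sfun_powr_le:
  fixes n d :: nat and \<alpha> t :: real
  assumes n: "n \<ge> 2" and \<alpha>: "\<alpha> > 1" and g: "\<And>u. finite u \<Longrightarrow> \<gamma> u > 0"
    and cbc: "is_CBC n d \<alpha> \<gamma> z" and t: "1 / \<alpha> < t" "t \<le> 1"
  shows "Sfun n d \<alpha> \<gamma> z powr t \<le> (2 powr (2 * \<alpha> * t + 1) + 1) / real (totient n) *
    (\<Sum>u\<in>Pow {1..d}. real (max (card u) 1) * \<gamma> u powr t * (2 * zeta (\<alpha> * t)) ^ card u)\<^sup>2"
proof -
  define a where "a = \<alpha> * t"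
  define q where "q = inv_r a (\<lambda>u. \<gamma> u powr t)"
  define R where "R = (\<lambda>s. infsum (\<lambda>(h, m). q h * q m) {(h, m) \<in> Zvec d \<times> Zvec d. h s \<noteq> 0 \<or> m s \<noteq> 0})"
  define C where "C = (\<Sum>u\<in>Pow {1..d}. real (max (card u) 1) * \<gamma> u powr t * (2 * zeta a) ^ card u)"
  define \<phi> where "\<phi> = real (totient n)"
  have t0: "0 < t" using t(1) \<alpha> by (meson less_trans zero_less_divide_1_iff zero_less_one)
  have a: "a > 1" using t \<alpha> by (simp add: a_def field_simps)
  have g': "0 \<le> \<gamma> u" if "finite u" for u using g[OF that] by simp
  have \<phi>: "\<phi> > 0" using n by (simp add: \<phi>_def)
  have step: "\<phi> * Tfun n d s \<alpha> \<gamma> z powr t \<le> 2 powr (a + 1) * R s" if s: "s \<in> {1..d}" for s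
  proof -
    have "\<phi> * Tfun n d s \<alpha> \<gamma> z powr t = (\<Sum>z'\<in>unitsU n. Tfun n d s \<alpha> \<gamma> z powr t)"
      using card_unitsU[OF n] by (simp add: \<phi>_def)
    also have "\<dots> \<le> (\<Sum>z'\<in>unitsU n. infsum (\<lambda>(h, l). q h * q (\<lambda>j. h j + l j)) (Zvec d \<times> dual_slice n s (z(s := z'))))"
    proof (rule sum_mono)
      fix z' assume z': "z' \<in> unitsU n"
      \<comment> \<open>The minimum is compared with every candidate, hence with their mean.
        \<open>Tfun\<close> at step \<open>s\<close> depends only on the components up to
        \<open>s\<close>, so the ones chosen later do not matter.\<close>
      have "Tfun n d s \<alpha> \<gamma> z powr t \<le> Tfun n d s \<alpha> \<gamma> (z(s := z')) powr t"
        using cbc s z' t0 g' \<alpha> by (intro powr_mono2 Tfun_nonneg) (auto simp: is_CBC_def)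
      also have "\<dots> \<le> infsum (\<lambda>(h, l). q h * q (\<lambda>j. h j + l j)) (Zvec d \<times> dual_slice n s (z(s := z')))"
        unfolding q_def a_def using \<alpha> a t t0 s g' by (intro Tfun_powr_le) (auto simp: a_def)
      finally show "Tfun n d s \<alpha> \<gamma> z powr t \<le>
        infsum (\<lambda>(h, l). q h * q (\<lambda>j. h j + l j)) (Zvec d \<times> dual_slice n s (z(s := z')))" .
    qed
    also have "\<dots> \<le> 2 powr (a + 1) * R s"
      unfolding R_def q_def using n a s by (intro sum_dual_slice_le) auto
    finally show ?thesis .
  qed
  have "\<phi> * Sfun n d \<alpha> \<gamma> z powr t = \<phi> * (\<Sum>s\<in>{1..d}. Tfun n d s \<alpha> \<gamma> z) powr t"
    using Sfun_eq_sum_Tfun[of \<alpha> \<gamma> n d z] \<alpha> g' by simp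
  also have "\<dots> \<le> \<phi> * (\<Sum>s\<in>{1..d}. Tfun n d s \<alpha> \<gamma> z powr t)"
    using \<phi> t0 t \<alpha> g' by (intro mult_left_mono powr_sum_le_sum_powr Tfun_nonneg) auto
  also have "\<dots> \<le> (\<Sum>s\<in>{1..d}. 2 powr (a + 1) * R s)"
    unfolding sum_distrib_left by (intro sum_mono step)
  also have "\<dots> = 2 powr (a + 1) * (\<Sum>s\<in>{1..d}. R s)"
    by (simp add: sum_distrib_left)
  also have "\<dots> \<le> 2 powr (a + 1) * (2 * C\<^sup>2)"
    unfolding R_def q_def C_def using a by (intro mult_left_mono sum_pair_inv_r_le) auto
  also have "\<dots> = 2 powr (a + 2) * C\<^sup>2"
    by (simp add: powr_add)
  also have "\<dots> \<le> (2 powr (2 * a + 1) + 1) * C\<^sup>2"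
  proof (rule mult_right_mono)
    have "2 powr (a + 2) \<le> 2 powr (2 * a + 1)" using a by (intro powr_mono) auto
    then show "2 powr (a + 2) \<le> 2 powr (2 * a + 1) + 1" by linarith
  qed simp
  finally have "Sfun n d \<alpha> \<gamma> z powr t \<le> (2 powr (2 * a + 1) + 1) * C\<^sup>2 / \<phi>"
    using \<phi> by (simp add: pos_le_divide_eq mult.commute)
  then show ?thesis by (simp add: C_def \<phi>_def a_def mult.assoc)
qed

text \<open>The vector with first coordinate \<open>n\<close> and all others 0 is a nonzero dual
  vector, and with \<open>h = 0\<close> it contributes a positive term. Positivity makes
  \<open>S powr (-1/2)\<close> a genuine truncation level.\<close>

lemma Sfun_pos:
  assumes "n > 0" "d \<ge> 1" "a > 1" and g: "\<And>u. finite u \<Longrightarrow> \<gamma> u > 0"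
  shows "0 < Sfun n d a \<gamma> z"
proof -
  let ?F = "\<lambda>(h, l). inv_r a \<gamma> h * inv_r a \<gamma> (\<lambda>j. h j + l j)"
  let ?l = "(\<lambda>_. 0)(1 := int n) :: nat \<Rightarrow> int"
  have g': "0 \<le> \<gamma> u" if "finite u" for u using g[OF that] by simp
  have pos: "0 < inv_r a \<gamma> h" if "finite (supp h)" for h
    using g[OF that] by (simp add: inv_r_def)
  have "(\<Sum>j\<in>{1..d}. ?l j * int (z j)) = int n * int (z 1)"
    using assms by (subst sum.remove[of _ 1]) auto
  then have l: "?l \<in> dual_nonzero n d z"
    using assms by (auto simp: dual_nonzero_def Zvec_def dual_cond_def fun_eq_iff)
  have supp: "supp (\<lambda>_. 0) = {}" "supp ?l = {1}" using assms by (auto simp: supp_def)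
  have "0 < ?F (\<lambda>_. 0, ?l)"
    using pos[of "\<lambda>_. 0"] pos[of ?l] supp by (simp del: fun_upd_apply)
  also have "\<dots> = sum ?F {(\<lambda>_. 0, ?l)}" by simp
  also have "\<dots> \<le> infsum ?F (Zvec d \<times> dual_nonzero n d z)"
  proof (rule finite_sum_le_infsum)
    show "?F summable_on Zvec d \<times> dual_nonzero n d z"
      using assms g' by (intro Sfun_summable)
    show "{(\<lambda>_. 0, ?l)} \<subseteq> Zvec d \<times> dual_nonzero n d z"
      using l by (simp add: Zvec_def)
    show "0 \<le> ?F x" if "x \<in> Zvec d \<times> dual_nonzero n d z - {(\<lambda>_. 0, ?l)}" for x
      using that g' Zvec_add
      by (auto simp: dual_nonzero_def intro!: mult_nonneg_nonneg inv_r_nonneg_Zvec[where d = d])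
  qed auto
  also have "\<dots> = Sfun n d a \<gamma> z"
    using assms g' by (intro Sfun_eq_infsum[symmetric])
  finally show ?thesis .
qed

section \<open>Constants independent of the dimension\<close>

lemma max_1_le_exp_power: "real (max k 1) \<le> exp (1 / exp 1) ^ k"
proof (cases "k = 0")
  case False
  \<comment> \<open>The tangent bound for \<open>ln\<close> at 1, used at \<open>k / exp 1\<close>,
    is \<open>k \<le> exp (k / exp 1)\<close>. This is the origin of the factor
    \<open>exp (1 / exp 1)\<close> in the summability condition.\<close>
  have "ln (real k / exp 1) \<le> real k / exp 1 - 1"
    using False by (intro ln_le_minus_one) auto
  then have "ln (real k) \<le> real k / exp 1"
    using False by (simp add: ln_div)
  then have "real k \<le> exp (real k / exp 1)"
    using False by (metis exp_le_cancel_iff exp_ln of_nat_0_less_iff neq0_conv)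
  also have "\<dots> = exp (1 / exp 1) ^ k"
    by (simp flip: exp_of_nat_mult)
  finally show ?thesis using False by simp
qed simp

text \<open>The cardinality factor is absorbed into an exponential in \<open>card u\<close>. The sum
  over subsets of \<open>{1..d}\<close> is then a partial sum of one convergent series over all
  finite sets, whose value does not involve \<open>d\<close>.\<close>

lemma err_const_bounded:
  fixes \<alpha> t :: real
  assumes "0 < t" "\<alpha> * t > 1"
    and summable: "(\<lambda>u. \<gamma> u powr t * (2 * exp (1 / exp 1) * zeta (\<alpha> * t)) ^ card u)
      summable_on {u. finite u \<and> u \<subseteq> {1..}}" (is "?f summable_on ?A")
  shows "\<exists>C. \<forall>d. err_const d \<alpha> \<gamma> t \<le> C"
proof (intro exI allI)
  fix d
  have z: "zeta (\<alpha> * t) \<ge> 0" using zeta_ge_1[OF assms(2)] by simp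
  have "(\<Sum>u\<in>Pow {1..d}. real (max (card u) 1) * \<gamma> u powr t * (2 * zeta (\<alpha> * t)) ^ card u)
      \<le> (\<Sum>u\<in>Pow {1..d}. exp (1 / exp 1) ^ card u * \<gamma> u powr t * (2 * zeta (\<alpha> * t)) ^ card u)"
    using z by (intro sum_mono mult_right_mono max_1_le_exp_power) auto
  also have "\<dots> = (\<Sum>u\<in>Pow {1..d}. ?f u)"
    by (intro sum.cong refl) (simp add: power_mult_distrib)
  also have "\<dots> \<le> infsum ?f ?A"
    using z by (intro finite_sum_le_infsum[OF summable]) (auto intro: finite_subset)
  finally show "err_const d \<alpha> \<gamma> t \<le> sqrt 2 * (2 powr (2 * \<alpha> * t + 1) + 1) powr (1 / (4 * t)) *
      infsum ?f ?A powr (1 / (2 * t))"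
    unfolding err_const_def using assms(1) z
    by (intro mult_left_mono powr_mono2 sum_nonneg) auto
qed

section \<open>Fourier series on the cube\<close>

lemma unit_interval_measure:
  "emeasure (restrict_space lborel {0..1::real}) (space (restrict_space lborel {0..1})) = 1"
  by (simp add: emeasure_restrict_space space_restrict_space)

lemma finite_measure_unit_interval: "finite_measure (restrict_space lborel {0..1::real})"
  by (rule finite_measureI, subst unit_interval_measure) simp

lemma product_sigma_finite_unit_interval:
  "product_sigma_finite (\<lambda>_::nat. restrict_space lborel {0..1::real})"
  unfolding product_sigma_finite_def
  by (intro allI sigma_finite_measure_restrict_space lborel.sigma_finite_measure_axioms) simp

lemma space_cube: "space (cube d) = (\<Pi>\<^sub>E j\<in>{1..d}. {0..1})"
  by (simp add: cube_def space_PiM space_restrict_space)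

lemma emeasure_cube: "emeasure (cube d) (space (cube d)) = 1"
proof -
  have "emeasure (cube d) (space (cube d)) =
      (\<Prod>j\<in>{1..d}. emeasure (restrict_space lborel {0..1::real}) (space (restrict_space lborel {0..1})))"
    unfolding cube_def space_PiM
    by (rule product_sigma_finite.emeasure_PiM[OF product_sigma_finite_unit_interval], simp, rule sets.top)
  then show ?thesis by (simp only: unit_interval_measure prod.neutral_const)
qed

lemma finite_measure_cube: "finite_measure (cube d)"
  by (rule finite_measureI) (simp add: emeasure_cube)

lemma measure_cube: "measure (cube d) (space (cube d)) = 1"
  by (simp add: measure_def emeasure_cube)

lemma integrable_cube_bounded:
  fixes f :: "(nat \<Rightarrow> real) \<Rightarrow> 'b :: {banach, second_countable_topology}"
  assumes "f \<in> borel_measurable (cube d)" "\<And>x. x \<in> space (cube d) \<Longrightarrow> norm (f x) \<le> B"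
  shows "integrable (cube d) f"
  using assms by (intro finite_measure.integrable_const_bound[OF finite_measure_cube, where B = B]) auto

lemma norm_integral_cube_le:
  fixes f :: "(nat \<Rightarrow> real) \<Rightarrow> 'b :: {banach, second_countable_topology}"
  assumes "f \<in> borel_measurable (cube d)" "\<And>x. x \<in> space (cube d) \<Longrightarrow> norm (f x) \<le> B"
  shows "norm (LINT x|cube d. f x) \<le> B"
proof -
  have int: "integrable (cube d) f" using assms by (rule integrable_cube_bounded)
  have "norm (LINT x|cube d. f x) \<le> (LINT x|cube d. norm (f x))"
    by (rule integral_norm_bound)
  also have "\<dots> \<le> (LINT x|cube d. B)"
    using int assms(2) by (intro integral_mono integrable_norm finite_measure.integrable_const[OF finite_measure_cube])
  also have "\<dots> = B" by (simp add: measure_cube)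
  finally show ?thesis .
qed

lemma measurable_ebasis: "ebasis d h \<in> borel_measurable (cube d)"
proof -
  have c: "(\<lambda>x. x j) \<in> borel_measurable (cube d)" if "j \<in> {1..d}" for j
  proof -
    have "(\<lambda>x. x j) \<in> measurable (cube d) (restrict_space lborel {0..1})"
      unfolding cube_def using that by (rule measurable_component_singleton)
    moreover have "(\<lambda>x. x) \<in> borel_measurable (restrict_space lborel {0..1::real})"
      by (intro measurable_restrict_space1) simp
    ultimately show ?thesis using measurable_compose by blast
  qed
  have "(\<lambda>x. dotp d h x) \<in> borel_measurable (cube d)"
    unfolding dotp_def using c by (intro borel_measurable_sum borel_measurable_times) auto
  then show ?thesis
    unfolding ebasis_def by measurable
qed

section \<open>Orthonormality of the exponentials\<close>

lemma norm_ebasis [simp]: "cmod (ebasis d h x) = 1"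
  by (simp add: ebasis_def)

lemma ebasis_mult_cnj: "ebasis d h x * cnj (ebasis d k x) = ebasis d (\<lambda>j. h j - k j) x"
proof -
  have "dotp d (\<lambda>j. h j - k j) x = dotp d h x - dotp d k x"
    by (simp add: dotp_def sum_subtractf left_diff_distrib)
  then show ?thesis
    by (simp add: ebasis_def exp_cnj flip: exp_add) (simp add: algebra_simps)
qed

lemma integral_unit_interval_exp:
  fixes k :: int
  shows "(LINT t|restrict_space lborel {0..1::real}. exp (2 * pi * \<i> * complex_of_real (of_int k * t))) = of_bool (k = 0)"
proof (cases "k = 0")
  case True
  have "measure (restrict_space lborel {0..1::real}) (space (restrict_space lborel {0..1})) = 1"
    unfolding measure_def unit_interval_measure by simp
  then show ?thesis using True by simp
next
  case False
  define w where "w = 2 * pi * \<i> * of_int k"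
  have w: "w \<noteq> 0" using False by (simp add: w_def)
  have "(LINT t|restrict_space lborel {0..1::real}. exp (2 * pi * \<i> * complex_of_real (of_int k * t))) =
      (LINT t|lborel. indicator {0..1::real} t *\<^sub>R exp (w * complex_of_real t))"
    by (subst integral_restrict_space) (auto simp: w_def mult.assoc)
  \<comment> \<open>An antiderivative is \<open>exp (w * t) / w\<close>; its values at 0 and 1
    coincide because \<open>w\<close> is an integer multiple of
    \<open>2 * pi * \<i>\<close>.\<close>
  also have "\<dots> = exp (w * complex_of_real 1) / w - exp (w * complex_of_real 0) / w"
  proof (rule integral_FTC_Icc)
    fix t :: real
    have "((\<lambda>u. exp (w * u) / w) has_field_derivative exp (w * of_real t)) (at (of_real t))"
      using w by (auto intro!: derivative_eq_intros)
    then have "((\<lambda>t. exp (w * complex_of_real t) / w) has_vector_derivative exp (w * of_real t)) (at t)"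
      by (rule has_vector_derivative_real_field)
    then show "((\<lambda>t. exp (w * complex_of_real t) / w) has_vector_derivative exp (w * of_real t)) (at t within {0..1})"
      by (rule has_vector_derivative_at_within)
  qed (auto intro!: continuous_intros)
  also have "exp (w * complex_of_real 1) = 1"
    using exp_integer_2pi[of "of_int k"] by (simp add: w_def mult_ac)
  finally show ?thesis using False by simp
qed

lemma integral_ebasis:
  assumes "h \<in> Zvec d"
  shows "(LINT x|cube d. ebasis d h x) = of_bool (h = (\<lambda>_. 0))"
proof -
  let ?e = "\<lambda>j t. exp (2 * pi * \<i> * complex_of_real (of_int (h j) * t))"
  have "ebasis d h x = (\<Prod>j\<in>{1..d}. ?e j (x j))" for x
    by (simp add: ebasis_def dotp_def exp_sum[symmetric] sum_distrib_left)
  then have "(LINT x|cube d. ebasis d h x) = (LINT x|cube d. (\<Prod>j\<in>{1..d}. ?e j (x j)))"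
    by simp
  also have "\<dots> = (\<Prod>j\<in>{1..d}. LINT t|restrict_space lborel {0..1::real}. ?e j t)"
    unfolding cube_def
  proof (rule product_sigma_finite.product_integral_prod[OF product_sigma_finite_unit_interval])
    fix j
    show "integrable (restrict_space lborel {0..1::real}) (?e j)"
    proof (rule finite_measure.integrable_const_bound[OF finite_measure_unit_interval, where B = 1])
      show "?e j \<in> borel_measurable (restrict_space lborel {0..1::real})"
        by (intro measurable_restrict_space1 borel_measurable_continuous_onI continuous_intros) simp
    qed simp
  qed simp
  also have "\<dots> = (\<Prod>j\<in>{1..d}. of_bool (h j = 0))"
    by (simp only: integral_unit_interval_exp)
  also have "\<dots> = of_bool (h = (\<lambda>_. 0))"
  proof (cases "h = (\<lambda>_. 0)")
    case False
    then obtain j where "h j \<noteq> 0" by (auto simp: fun_eq_iff)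
    moreover from this have "j \<in> {1..d}" using assms by (auto simp: Zvec_def)
    ultimately show ?thesis using False by (subst prod_zero) auto
  qed simp
  finally show ?thesis .
qed

text \<open>The bound does not depend on \<open>x\<close>, so the series converges uniformly; with
  \<open>F\<close> empty it also gives a uniform bound on the sum.\<close>

lemma ebasis_series_tail:
  assumes c: "(\<lambda>h. cmod (c h)) summable_on X" and F: "finite F" "F \<subseteq> X"
  shows "cmod ((\<Sum>\<^sub>\<infinity>h\<in>X. c h * ebasis d h x) - (\<Sum>h\<in>F. c h * ebasis d h x))
    \<le> (\<Sum>\<^sub>\<infinity>h\<in>X. cmod (c h)) - (\<Sum>h\<in>F. cmod (c h))"
proof -
  have abs: "(\<lambda>h. cmod (c h * ebasis d h x)) summable_on X"
    using c by (simp add: norm_mult)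
  have "(\<Sum>\<^sub>\<infinity>h\<in>X. c h * ebasis d h x) - (\<Sum>h\<in>F. c h * ebasis d h x) = (\<Sum>\<^sub>\<infinity>h\<in>X - F. c h * ebasis d h x)"
    using abs_summable_summable[OF abs] F by (subst infsum_Diff) auto
  also have "cmod \<dots> \<le> (\<Sum>\<^sub>\<infinity>h\<in>X - F. cmod (c h * ebasis d h x))"
    by (rule norm_infsum_bound, rule summable_on_subset_banach[OF abs]) auto
  also have "\<dots> = (\<Sum>\<^sub>\<infinity>h\<in>X. cmod (c h)) - (\<Sum>h\<in>F. cmod (c h))"
    using c F by (simp add: norm_mult infsum_Diff)
  finally show ?thesis .
qed

text \<open>Termwise integration: the error of a finite partial sum is at most the uniform tail
  times \<open>B\<close>, which tends to 0. The bounded factor \<open>f\<close> allows two uses,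
  with a conjugated exponential and with the conjugate of the series itself.\<close>

lemma has_sum_integral_ebasis_series:
  assumes c: "(\<lambda>h. cmod (c h)) summable_on X"
    and g: "g \<in> borel_measurable (cube d)"
    and series: "\<And>x. x \<in> space (cube d) \<Longrightarrow> g x = (\<Sum>\<^sub>\<infinity>h\<in>X. c h * ebasis d h x)"
    and f: "f \<in> borel_measurable (cube d)" "\<And>x. x \<in> space (cube d) \<Longrightarrow> cmod (f x) \<le> B"
  shows "((\<lambda>h. c h * (LINT x|cube d. ebasis d h x * f x)) has_sum (LINT x|cube d. g x * f x)) X"
proof -
  let ?T = "\<Sum>\<^sub>\<infinity>h\<in>X. cmod (c h)"
  have [measurable]: "ebasis d h \<in> borel_measurable (cube d)" for h by (rule measurable_ebasis)
  note [measurable] = g f(1)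
  have gB: "cmod (g x) \<le> ?T" if "x \<in> space (cube d)" for x
    using ebasis_series_tail[OF c, of "{}" d x] series[OF that] by simp
  have bound: "cmod ((\<Sum>h\<in>F. c h * (LINT x|cube d. ebasis d h x * f x)) - (LINT x|cube d. g x * f x))
      \<le> (?T - (\<Sum>h\<in>F. cmod (c h))) * B" if F: "finite F" "F \<subseteq> X" for F
  proof -
    have int: "integrable (cube d) (\<lambda>x. c h * (ebasis d h x * f x))" for h
      using f(2) by (intro integrable_cube_bounded[where B = "cmod (c h) * B"])
        (auto simp: norm_mult intro!: mult_left_mono)
    have intg: "integrable (cube d) (\<lambda>x. g x * f x)"
    proof (rule integrable_cube_bounded)
      fix x assume x: "x \<in> space (cube d)"
      show "cmod (g x * f x) \<le> ?T * B"
        unfolding norm_mult using gB[OF x] f(2)[OF x] c by (intro mult_mono infsum_nonneg) auto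
    qed measurable
    have "(\<Sum>h\<in>F. c h * (LINT x|cube d. ebasis d h x * f x)) - (LINT x|cube d. g x * f x) =
        (LINT x|cube d. (\<Sum>h\<in>F. c h * (ebasis d h x * f x)) - g x * f x)"
      using int intg by (simp add: Bochner_Integration.integral_diff Bochner_Integration.integral_sum)
    also have "cmod \<dots> \<le> (?T - (\<Sum>h\<in>F. cmod (c h))) * B"
    proof (rule norm_integral_cube_le)
      fix x assume x: "x \<in> space (cube d)"
      have "cmod ((\<Sum>h\<in>F. c h * (ebasis d h x * f x)) - g x * f x) =
          cmod (g x - (\<Sum>h\<in>F. c h * ebasis d h x)) * cmod (f x)"
        by (subst norm_minus_commute) (simp add: left_diff_distrib sum_distrib_right mult.assoc flip: norm_mult)
      also have "\<dots> \<le> (?T - (\<Sum>h\<in>F. cmod (c h))) * B"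
        using ebasis_series_tail[OF c F, of d x] f(2)[OF x]
          order_trans[OF norm_ge_zero ebasis_series_tail[OF c F, of d x]]
        by (intro mult_mono) (simp_all add: series[OF x])
      finally show "cmod ((\<Sum>h\<in>F. c h * (ebasis d h x * f x)) - g x * f x) \<le> (?T - (\<Sum>h\<in>F. cmod (c h))) * B" .
    qed measurable
    finally show ?thesis .
  qed
  have "((\<lambda>F. (?T - (\<Sum>h\<in>F. cmod (c h))) * B) \<longlongrightarrow> (?T - ?T) * B) (finite_subsets_at_top X)"
    using has_sum_infsum[OF c] unfolding has_sum_def by (intro tendsto_intros)
  then have "((\<lambda>F. (?T - (\<Sum>h\<in>F. cmod (c h))) * B) \<longlongrightarrow> 0) (finite_subsets_at_top X)" by simp
  then have "((\<lambda>F. (\<Sum>h\<in>F. c h * (LINT x|cube d. ebasis d h x * f x)) - (LINT x|cube d. g x * f x)) \<longlongrightarrow> 0)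
      (finite_subsets_at_top X)"
    by (rule Lim_null_comparison[rotated])
       (use bound in \<open>auto intro!: eventually_finite_subsets_at_top_weakI\<close>)
  then show ?thesis
    unfolding has_sum_def using Lim_null by blast
qed

text \<open>Integrating termwise against a conjugated exponential recovers the coefficient
  \<open>c k\<close> by orthogonality. Integrating termwise against \<open>cnj (g x)\<close> then
  turns each term into \<open>c h * cnj (c h)\<close>.\<close>

lemma parseval_ebasis_series:
  assumes c: "(\<lambda>h. cmod (c h)) summable_on Zvec d"
    and g: "g \<in> borel_measurable (cube d)"
    and series: "\<And>x. x \<in> space (cube d) \<Longrightarrow> g x = (\<Sum>\<^sub>\<infinity>h\<in>Zvec d. c h * ebasis d h x)"
  shows "((\<lambda>h. (cmod (c h))\<^sup>2) has_sum (LINT x|cube d. (cmod (g x))\<^sup>2)) (Zvec d)"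
proof -
  have gB: "cmod (g x) \<le> (\<Sum>\<^sub>\<infinity>h\<in>Zvec d. cmod (c h))" if "x \<in> space (cube d)" for x
    using ebasis_series_tail[OF c, of "{}" d x] series[OF that] by simp
  have cnj_meas: "(\<lambda>x. cnj (f x)) \<in> borel_measurable (cube d)" if "f \<in> borel_measurable (cube d)" for f
    using that by (rule borel_measurable_continuous_on[OF continuous_on_cnj[OF continuous_on_id]])
  have coeff: "(LINT x|cube d. g x * cnj (ebasis d k x)) = c k" if k: "k \<in> Zvec d" for k
  proof -
    have "((\<lambda>h. c h * (LINT x|cube d. ebasis d h x * cnj (ebasis d k x))) has_sum
        (LINT x|cube d. g x * cnj (ebasis d k x))) (Zvec d)"
      by (rule has_sum_integral_ebasis_series[OF c g series, where B = 1])
         (auto intro!: cnj_meas measurable_ebasis)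
    moreover have "(LINT x|cube d. ebasis d h x * cnj (ebasis d k x)) = of_bool (h = k)" if "h \<in> Zvec d" for h
      using that k unfolding ebasis_mult_cnj
      by (subst integral_ebasis) (auto simp: Zvec_def fun_eq_iff)
    ultimately have "((\<lambda>h. c h * of_bool (h = k)) has_sum (LINT x|cube d. g x * cnj (ebasis d k x))) (Zvec d)"
      by (simp cong: has_sum_cong)
    moreover have "((\<lambda>h. c h * of_bool (h = k)) has_sum c k) (Zvec d)"
      by (rule has_sum_finite_neutralI[where B = "{k}"]) (use k in auto)
    ultimately show ?thesis by (rule has_sum_unique)
  qed
  have pairing: "((\<lambda>h. c h * (LINT x|cube d. ebasis d h x * cnj (g x))) has_sum (LINT x|cube d. g x * cnj (g x))) (Zvec d)"
    by (rule has_sum_integral_ebasis_series[OF c g series, where B = "\<Sum>\<^sub>\<infinity>h\<in>Zvec d. cmod (c h)"])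
       (use gB in \<open>auto intro!: cnj_meas g\<close>)
  have summand: "c h * (LINT x|cube d. ebasis d h x * cnj (g x)) = of_real ((cmod (c h))\<^sup>2)" if "h \<in> Zvec d" for h
  proof -
    have "(LINT x|cube d. ebasis d h x * cnj (g x)) = (LINT x|cube d. cnj (g x * cnj (ebasis d h x)))"
      by (simp add: mult.commute)
    also have "\<dots> = cnj (c h)" by (subst Bochner_Integration.integral_cnj) (simp add: coeff[OF that])
    finally show ?thesis using complex_norm_square[of "c h"] by simp
  qed
  have "(LINT x|cube d. g x * cnj (g x)) = of_real (LINT x|cube d. (cmod (g x))\<^sup>2)"
    by (subst integral_complex_of_real[symmetric]) (simp only: complex_norm_square)
  with has_sum_cong[THEN iffD1, OF summand pairing]
  have "((\<lambda>h. of_real ((cmod (c h))\<^sup>2) :: complex) has_sum of_real (LINT x|cube d. (cmod (g x))\<^sup>2)) (Zvec d)"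
    by (simp only:)
  then show ?thesis by (simp only: has_sum_of_real_iff)
qed

section \<open>The lattice algorithm\<close>

lemma lpt_in_space: "lpt n d z k \<in> space (cube d)"
  by (auto simp: space_cube lpt_def frac_ge_0 less_imp_le[OF frac_lt_1])

text \<open>Taking fractional parts changes the dot product by an integer, which the exponential
  does not see. The values at the nodes are thus powers of one root of unity.\<close>

lemma ebasis_lpt:
  fixes m :: "nat \<Rightarrow> int"
  shows "ebasis d m (lpt n d z k) =
    exp (2 * pi * \<i> * (of_int (\<Sum>j\<in>{1..d}. m j * int (z j)) / of_nat n)) ^ k"
proof -
  define S where "S = (\<Sum>j\<in>{1..d}. m j * int (z j))"
  define N where "N = (\<Sum>j\<in>{1..d}. m j * \<lfloor>real k * real (z j) / real n\<rfloor>)"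
  have "dotp d m (lpt n d z k) = (\<Sum>j\<in>{1..d}. real k * of_int (m j * int (z j)) / real n
      - of_int (m j * \<lfloor>real k * real (z j) / real n\<rfloor>))"
    unfolding dotp_def lpt_def by (intro sum.cong refl) (simp add: frac_def algebra_simps)
  also have "\<dots> = real k * of_int S / real n - of_int N"
    by (simp add: S_def N_def sum_subtractf sum_distrib_left sum_divide_distrib)
  finally have dot: "dotp d m (lpt n d z k) = real k * of_int S / real n - of_int N" .
  have "ebasis d m (lpt n d z k) =
      exp (of_nat k * (2 * pi * \<i> * (of_int S / of_nat n)) - (2 * of_int N * pi) * \<i>)"
    unfolding ebasis_def dot by (simp add: algebra_simps)
  also have "\<dots> = exp (of_nat k * (2 * pi * \<i> * (of_int S / of_nat n)))"
    using exp_integer_2pi[of "of_int N"] by (simp add: exp_diff)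
  finally show ?thesis by (simp only: exp_of_nat_mult S_def)
qed

lemma character_sum:
  fixes S :: int
  assumes "n > 0"
  shows "(\<Sum>k\<in>{1..n}. exp (2 * pi * \<i> * (of_int S / of_nat n)) ^ k) = (if S mod int n = 0 then of_nat n else 0)"
proof -
  define w where "w = exp (2 * pi * \<i> * (of_int S / of_nat n))"
  have w1: "w = 1 \<longleftrightarrow> S mod int n = 0"
  proof
    assume "w = 1"
    then obtain N :: int where N: "2 * pi * (of_int S / real n) = of_int (2 * N) * pi"
      unfolding w_def exp_eq_1 by auto
    then have "of_int S = of_int N * real n" using assms by (simp add: field_simps)
    then have "S = N * int n" by (metis of_int_eq_iff of_int_mult of_int_of_nat_eq)
    then show "S mod int n = 0" by simp
  next
    assume "S mod int n = 0"
    then obtain N where "S = int n * N" by (metis dvd_eq_mod_eq_0 dvd_def)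
    then have "w = exp ((2 * of_int N * pi) * \<i>)"
      using assms by (simp add: w_def mult_ac)
    then show "w = 1" by (simp only: exp_integer_2pi Ints_of_int)
  qed
  have "w ^ n = exp (of_nat n * (2 * pi * \<i> * (of_int S / of_nat n)))"
    by (simp only: w_def exp_of_nat_mult)
  also have "\<dots> = exp ((2 * of_int S * pi) * \<i>)"
    using assms by (simp add: mult_ac)
  also have "\<dots> = 1" by (simp only: exp_integer_2pi Ints_of_int)
  finally have wn: "w ^ n = 1" .
  \<comment> \<open>Starting at 1 instead of 0 costs a factor \<open>w\<close>, which is harmless:
    either \<open>w = 1\<close> or the geometric sum is 0.\<close>
  have "(\<Sum>k\<in>{1..n}. w ^ k) = w * (\<Sum>k<n. w ^ k)"
    by (simp add: sum.atLeast1_atMost_eq sum_distrib_left)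
  also have "\<dots> = (if S mod int n = 0 then of_nat n else 0)"
    using w1 wn by (auto simp: geometric_sum)
  finally show ?thesis by (simp add: w_def)
qed

text \<open>Inserting the Fourier series at the nodes, the character sum keeps just those
  \<open>m\<close> for which \<open>m - h\<close> is in the dual lattice. Writing
  \<open>m = h + l\<close> and removing \<open>l = 0\<close> leaves the aliasing error.\<close>

lemma fhat_a_aliasing:
  assumes n: "n > 0" and c: "(\<lambda>h. cmod (c h)) summable_on Zvec d"
    and series: "\<And>x. x \<in> space (cube d) \<Longrightarrow> f x = (\<Sum>\<^sub>\<infinity>h\<in>Zvec d. c h * ebasis d h x)"
    and h: "h \<in> Zvec d"
  shows "((\<lambda>l. c (\<lambda>j. h j + l j)) has_sum (fhat_a n d z f h - c h)) (dual_nonzero n d z)"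
proof -
  let ?t = "lpt n d z"
  let ?D = "{l \<in> Zvec d. dual_cond n d z l}"
  have 1: "((\<lambda>m. c m * ebasis d (\<lambda>j. m j - h j) (?t k)) has_sum f (?t k) * cnj (ebasis d h (?t k))) (Zvec d)" for k
  proof -
    have "(\<lambda>m. c m * ebasis d m (?t k)) summable_on Zvec d"
      by (rule abs_summable_summable) (use c in \<open>simp add: norm_mult\<close>)
    then have "((\<lambda>m. c m * ebasis d m (?t k)) has_sum f (?t k)) (Zvec d)"
      unfolding series[OF lpt_in_space] by (rule has_sum_infsum)
    from has_sum_cmult_left[OF this, of "cnj (ebasis d h (?t k))"]
    show ?thesis by (simp add: mult.assoc ebasis_mult_cnj)
  qed
  have "((\<lambda>m. (1 / of_nat n) * (\<Sum>k\<in>{1..n}. c m * ebasis d (\<lambda>j. m j - h j) (?t k))) has_sum fhat_a n d z f h) (Zvec d)"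
    unfolding fhat_a_def by (intro has_sum_cmult_right has_sum_finite_sum 1) simp
  moreover have "(1 / of_nat n) * (\<Sum>k\<in>{1..n}. c m * ebasis d (\<lambda>j. m j - h j) (?t k)) =
      c m * of_bool (dual_cond n d z (\<lambda>j. m j - h j))" for m
    unfolding ebasis_lpt sum_distrib_left[symmetric] character_sum[OF n] dual_cond_def
    using n by auto
  ultimately have "((\<lambda>m. c m * of_bool (dual_cond n d z (\<lambda>j. m j - h j))) has_sum fhat_a n d z f h) (Zvec d)"
    by simp
  then have "(c has_sum fhat_a n d z f h) {m \<in> Zvec d. dual_cond n d z (\<lambda>j. m j - h j)}"
    by (subst has_sum_cong_neutral[where T = "Zvec d" and g = "\<lambda>m. c m * of_bool (dual_cond n d z (\<lambda>j. m j - h j))"]) auto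
  moreover have "bij_betw (\<lambda>l j. h j + l j) ?D {m \<in> Zvec d. dual_cond n d z (\<lambda>j. m j - h j)}"
    by (rule bij_betwI[where g = "\<lambda>m j. m j - h j"])
       (use h in \<open>auto simp: Zvec_add Zvec_def\<close>)
  ultimately have 2: "((\<lambda>l. c (\<lambda>j. h j + l j)) has_sum fhat_a n d z f h) ?D"
    using has_sum_reindex_bij_betw[of "\<lambda>l j. h j + l j" ?D _ c] by simp
  have 3: "((\<lambda>l. c (\<lambda>j. h j + l j)) has_sum c h) {\<lambda>_. 0}"
    using has_sum_finite[of "{\<lambda>_. 0}" "\<lambda>l. c (\<lambda>j. h j + l j)"] by simp
  have "((\<lambda>l. c (\<lambda>j. h j + l j)) has_sum (fhat_a n d z f h - c h)) (?D - {\<lambda>_. 0})"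
    by (rule has_sum_Diff[OF 2 3]) (auto simp: Zvec_def dual_cond_def)
  moreover have "?D - {\<lambda>_. 0} = dual_nonzero n d z"
    by (auto simp: dual_nonzero_def)
  ultimately show ?thesis by simp
qed

text \<open>Weighted Cauchy-Schwarz: \<open>cmod (u l)\<close> is split as
  \<open>cmod (u l) * sqrt (r l)\<close> times \<open>1 / sqrt (r l)\<close> on finite sets, and the
  bound passes to the infinite sum.\<close>

lemma norm_infsum_squared_le:
  fixes u :: "'a \<Rightarrow> complex"
  assumes u: "(\<lambda>l. cmod (u l)) summable_on A" and r: "\<And>l. l \<in> A \<Longrightarrow> r l > 0"
    and P: "(\<lambda>l. (cmod (u l))\<^sup>2 * r l) summable_on A" and Q: "(\<lambda>l. 1 / r l) summable_on A"
  shows "(cmod (infsum u A))\<^sup>2 \<le> infsum (\<lambda>l. (cmod (u l))\<^sup>2 * r l) A * infsum (\<lambda>l. 1 / r l) A"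
proof -
  let ?P = "infsum (\<lambda>l. (cmod (u l))\<^sup>2 * r l) A" and ?Q = "infsum (\<lambda>l. 1 / r l) A"
  have nn: "0 \<le> ?P" "0 \<le> ?Q" using r by (auto intro!: infsum_nonneg simp: less_imp_le)
  have "cmod (infsum u A) \<le> infsum (\<lambda>l. cmod (u l)) A"
    by (rule norm_infsum_bound[OF u])
  also have "\<dots> \<le> sqrt (?P * ?Q)"
  proof (rule infsum_le_finite_sums[OF u])
    fix F assume F: "finite F" "F \<subseteq> A"
    have "(\<Sum>l\<in>F. cmod (u l))\<^sup>2 = (\<Sum>l\<in>F. (cmod (u l) * sqrt (r l)) * (1 / sqrt (r l)))\<^sup>2"
      using F r by (intro arg_cong[where f = "\<lambda>x. x\<^sup>2"] sum.cong) fastforce+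
    also have "\<dots> \<le> (\<Sum>l\<in>F. (cmod (u l) * sqrt (r l))\<^sup>2) * (\<Sum>l\<in>F. (1 / sqrt (r l))\<^sup>2)"
      by (rule Cauchy_Schwarz_ineq_sum)
    also have "\<dots> = (\<Sum>l\<in>F. (cmod (u l))\<^sup>2 * r l) * (\<Sum>l\<in>F. 1 / r l)"
      using F r by (intro arg_cong2[where f = "(*)"] sum.cong refl)
        (auto simp: power_mult_distrib power_divide less_imp_le subset_iff)
    also have "\<dots> \<le> ?P * ?Q"
      using F r nn P Q by (intro mult_mono finite_sum_le_infsum sum_nonneg) (auto simp: less_imp_le subset_iff)
    finally show "(\<Sum>l\<in>F. cmod (u l)) \<le> sqrt (?P * ?Q)"
      by (rule real_le_rsqrt)
  qed
  finally have "(cmod (infsum u A))\<^sup>2 \<le> (sqrt (?P * ?Q))\<^sup>2" by (intro power_mono) auto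
  then show ?thesis using nn by simp
qed

text \<open>Each member contributes at least \<open>1 / M\<close> to the convergent sum of
  \<open>inv_r\<close>. Finiteness matters for \<open>lattice_approx\<close>, whose sum would take
  the default value 0 on an infinite index set.\<close>

lemma finite_Aset:
  assumes "\<alpha> > 1" "\<And>u. finite u \<Longrightarrow> \<gamma> u > 0" "M > 0"
  shows "finite (Aset d \<alpha> \<gamma> M)"
proof -
  have q: "1 / M \<le> inv_r \<alpha> \<gamma> h" if "h \<in> Aset d \<alpha> \<gamma> M" for h
  proof -
    have "finite (supp h)"
      using that finite_supp_vecs[of "{1..d}" h] by (simp add: Aset_def Zvec_eq_vecs)
    then have "0 < rfun \<alpha> \<gamma> h" using assms(2) by (simp add: rfun_def)
    then have "1 / M \<le> 1 / rfun \<alpha> \<gamma> h"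
      using that by (intro divide_left_mono) (auto simp: Aset_def assms)
    then show ?thesis by (simp add: inverse_rfun)
  qed
  have g: "\<And>u. finite u \<Longrightarrow> 0 \<le> \<gamma> u" using assms(2) less_imp_le by blast
  have "(inv_r \<alpha> \<gamma> has_sum (\<Sum>u\<in>Pow {1..d}. \<gamma> u * (2 * zeta \<alpha>) ^ card u)) (Zvec d)"
    unfolding Zvec_eq_vecs using assms(1) g by (intro inv_r_has_sum) auto
  then have summ: "inv_r \<alpha> \<gamma> summable_on Zvec d" by (rule has_sum_imp_summable)
  have sub: "Aset d \<alpha> \<gamma> M \<subseteq> Zvec d" by (auto simp: Aset_def)
  have "(\<lambda>_. 1 / M) summable_on Aset d \<alpha> \<gamma> M"
    by (rule summable_on_comparison_test[OF summable_on_subset_banach[OF summ sub]])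
       (use q assms in auto)
  then show ?thesis using assms(3) infsum_diverge_constant[of "Aset d \<alpha> \<gamma> M" "1 / M"] by auto
qed

text \<open>Any positive \<open>M\<close> is allowed here; the two parts of the bound are balanced
  only afterwards.\<close>

lemma L2norm_error_squared_le:
  fixes n d :: nat and \<alpha> M :: real
  assumes n: "n > 0" and \<alpha>: "\<alpha> > 1" and \<gamma>: "\<And>u. finite u \<Longrightarrow> \<gamma> u > 0" and M: "M > 0"
    and f: "f \<in> korobov_ball d \<alpha> \<gamma>"
  shows "(L2norm d (\<lambda>x. f x - lattice_approx n d \<alpha> \<gamma> M z f x))\<^sup>2 \<le> 1 / M + M * Sfun n d \<alpha> \<gamma> z"
proof -
  let ?X = "Zvec d" and ?A = "Aset d \<alpha> \<gamma> M" and ?L = "dual_nonzero n d z"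
  define c where "c = fhat d f"
  define q where "q = inv_r \<alpha> \<gamma>"
  define Q where "Q = (\<lambda>h. infsum (\<lambda>l. q (\<lambda>j. h j + l j)) ?L)"
  \<comment> \<open>The Fourier coefficients of the error: the aliasing error inside the index set,
    the untouched coefficient outside.\<close>
  define e where "e = (\<lambda>h. c h - (if h \<in> ?A then fhat_a n d z f h else 0))"
  define g where "g = (\<lambda>x. f x - lattice_approx n d \<alpha> \<gamma> M z f x)"
  have fm: "f \<in> borel_measurable (cube d)" and c: "(\<lambda>h. cmod (c h)) summable_on ?X"
    and series: "\<And>x. x \<in> space (cube d) \<Longrightarrow> f x = (\<Sum>\<^sub>\<infinity>h\<in>?X. c h * ebasis d h x)"
    and normsum: "(\<lambda>h. (cmod (c h))\<^sup>2 * rfun \<alpha> \<gamma> h) summable_on ?X"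
    and norm1: "(\<Sum>\<^sub>\<infinity>h\<in>?X. (cmod (c h))\<^sup>2 * rfun \<alpha> \<gamma> h) \<le> 1"
    using f by (auto simp: korobov_ball_def korobov_def c_def)
  have \<gamma>': "0 \<le> \<gamma> u" if "finite u" for u using \<gamma>[OF that] by simp
  have rpos: "0 < rfun \<alpha> \<gamma> h" if "h \<in> ?X" for h
    using that \<gamma> finite_supp_vecs[of "{1..d}" h] by (simp add: rfun_def Zvec_eq_vecs)
  have q_inv: "q h = 1 / rfun \<alpha> \<gamma> h" for h by (simp add: q_def inverse_rfun)
  have qnn: "0 \<le> q h" if "h \<in> ?X" for h using rpos[OF that] by (simp add: q_inv)
  have finA: "finite ?A" using \<alpha> \<gamma> M by (rule finite_Aset)
  have AX: "?A \<subseteq> ?X" by (auto simp: Aset_def)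
  have LX: "?L \<subseteq> ?X" by (auto simp: dual_nonzero_def)
  have hl: "(\<lambda>j. h j + l j) \<in> ?X" if "h \<in> ?X" "l \<in> ?L" for h l
    using that LX by (intro Zvec_add) auto
  have summS: "(\<lambda>(h, l). q h * q (\<lambda>j. h j + l j)) summable_on ?X \<times> ?L"
    unfolding q_def using \<alpha> \<gamma>' by (intro Sfun_summable) auto
  have summqQ: "(\<lambda>h. q h * Q h) summable_on ?X"
    using summable_on_infsum_sections[OF summS] by (simp add: Q_def infsum_cmult_right')
  have S_eq: "Sfun n d \<alpha> \<gamma> z = infsum (\<lambda>h. q h * Q h) ?X"
    unfolding Sfun_def inverse_rfun Q_def q_def dual_nonzero_def ..
  have summQ: "(\<lambda>l. q (\<lambda>j. h j + l j)) summable_on ?L" if h: "h \<in> ?X" for h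
  proof -
    have "(\<lambda>l. q h * q (\<lambda>j. h j + l j)) summable_on ?L"
      using summable_on_SigmaD1[of "\<lambda>h l. q h * q (\<lambda>j. h j + l j)", OF summS h] .
    moreover have "q h \<noteq> 0" using rpos[OF h] by (simp add: q_inv)
    ultimately show ?thesis by (metis summable_on_cmult_right')
  qed
  have inj: "inj_on (\<lambda>l j. h j + l j) ?L" for h
    by (auto simp: inj_on_def fun_eq_iff)
  have err_A: "(cmod (e h))\<^sup>2 \<le> Q h" if h: "h \<in> ?A" for h
  proof -
    have hX: "h \<in> ?X" using h AX by blast
    have sub: "(\<lambda>l j. h j + l j) ` ?L \<subseteq> ?X" using hl[OF hX] by auto
    let ?u = "\<lambda>l. c (\<lambda>j. h j + l j)" and ?r = "\<lambda>l. rfun \<alpha> \<gamma> (\<lambda>j. h j + l j)"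
    \<comment> \<open>Translation by \<open>h\<close> embeds the dual vectors into
      \<open>Zvec d\<close>, so nonnegative sums over them are partial sums of sums over
      \<open>Zvec d\<close>.\<close>
    have reidx: "(\<lambda>l. F (\<lambda>j. h j + l j)) summable_on ?L"
        "infsum (\<lambda>l. F (\<lambda>j. h j + l j)) ?L \<le> infsum F ?X"
      if "F summable_on ?X" "\<And>x. x \<in> ?X \<Longrightarrow> 0 \<le> F x" for F :: "_ \<Rightarrow> real"
    proof -
      have 1: "F summable_on (\<lambda>l j. h j + l j) ` ?L"
        using that(1) sub by (rule summable_on_subset_banach)
      then show "(\<lambda>l. F (\<lambda>j. h j + l j)) summable_on ?L"
        using summable_on_reindex[OF inj, of F] by (simp add: o_def)
      have "infsum (\<lambda>l. F (\<lambda>j. h j + l j)) ?L = infsum F ((\<lambda>l j. h j + l j) ` ?L)"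
        using infsum_reindex[OF inj, of F] by (simp add: o_def)
      also have "\<dots> \<le> infsum F ?X"
        using 1 that sub by (intro infsum_mono2) auto
      finally show "infsum (\<lambda>l. F (\<lambda>j. h j + l j)) ?L \<le> infsum F ?X" .
    qed
    have "infsum ?u ?L = fhat_a n d z f h - c h"
      by (rule infsumI, rule fhat_a_aliasing[OF n c series hX])
    then have "(cmod (e h))\<^sup>2 = (cmod (infsum ?u ?L))\<^sup>2"
      using h by (simp add: e_def norm_minus_commute)
    also have "\<dots> \<le> infsum (\<lambda>l. (cmod (?u l))\<^sup>2 * ?r l) ?L * infsum (\<lambda>l. 1 / ?r l) ?L"
    proof (rule norm_infsum_squared_le)
      show "(\<lambda>l. cmod (?u l)) summable_on ?L" by (rule reidx(1)[OF c]) simp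
      show "0 < ?r l" if "l \<in> ?L" for l using rpos hl[OF hX that] by blast
      show "(\<lambda>l. (cmod (?u l))\<^sup>2 * ?r l) summable_on ?L"
        by (rule reidx(1)[OF normsum]) (use rpos in \<open>simp add: less_imp_le\<close>)
      show "(\<lambda>l. 1 / ?r l) summable_on ?L" using summQ[OF hX] by (simp add: q_inv)
    qed
    also have "\<dots> \<le> 1 * infsum (\<lambda>l. 1 / ?r l) ?L"
    proof (rule mult_right_mono)
      have "infsum (\<lambda>l. (cmod (?u l))\<^sup>2 * ?r l) ?L \<le> infsum (\<lambda>h. (cmod (c h))\<^sup>2 * rfun \<alpha> \<gamma> h) ?X"
        by (rule reidx(2)[OF normsum]) (use rpos in \<open>simp add: less_imp_le\<close>)
      then show "infsum (\<lambda>l. (cmod (?u l))\<^sup>2 * ?r l) ?L \<le> 1" using norm1 by linarith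
      show "0 \<le> infsum (\<lambda>l. 1 / ?r l) ?L"
        using rpos hl[OF hX] by (intro infsum_nonneg) (simp add: less_imp_le)
    qed
    finally show ?thesis by (simp add: Q_def q_inv)
  qed
  have Qnn: "0 \<le> Q h" if "h \<in> ?X" for h
    unfolding Q_def using qnn hl[OF that] by (intro infsum_nonneg) auto
  \<comment> \<open>One bound for both cases: inside the index set \<open>1 \<le> M * q h\<close>
    brings in the second term, outside it \<open>1 \<le> rfun \<alpha> \<gamma> h / M\<close> brings
    in the first, and the other term is nonnegative.\<close>
  have point: "(cmod (e h))\<^sup>2 \<le> 1 / M * ((cmod (c h))\<^sup>2 * rfun \<alpha> \<gamma> h) + M * (q h * Q h)" if h: "h \<in> ?X" for h
  proof (cases "h \<in> ?A")
    case True
    then have "1 \<le> M * q h" using rpos[OF h] by (simp add: q_inv Aset_def)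
    from mult_right_mono[OF this Qnn[OF h]]
    have "Q h \<le> M * (q h * Q h)" by (simp add: mult.assoc)
    moreover have "0 \<le> 1 / M * ((cmod (c h))\<^sup>2 * rfun \<alpha> \<gamma> h)"
      using rpos[OF h] M by simp
    ultimately show ?thesis using err_A[OF True] by linarith
  next
    case False
    then have "1 \<le> rfun \<alpha> \<gamma> h / M" using h M by (simp add: Aset_def)
    from mult_left_mono[OF this, of "(cmod (c h))\<^sup>2"]
    have "(cmod (c h))\<^sup>2 \<le> 1 / M * ((cmod (c h))\<^sup>2 * rfun \<alpha> \<gamma> h)" by (simp add: mult_ac)
    moreover have "0 \<le> M * (q h * Q h)" using M qnn[OF h] Qnn[OF h] by simp
    ultimately show ?thesis using False by (simp add: e_def)
  qed
  have pars: "((\<lambda>h. (cmod (e h))\<^sup>2) has_sum (LINT x|cube d. (cmod (g x))\<^sup>2)) ?X"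
  proof (rule parseval_ebasis_series)
    have "(\<lambda>h. cmod (if h \<in> ?A then fhat_a n d z f h else 0)) summable_on ?X"
      by (rule has_sum_imp_summable, rule has_sum_finite_neutralI[OF finA AX]) auto
    from summable_on_add[OF c this]
    show "(\<lambda>h. cmod (e h)) summable_on ?X"
      by (rule summable_on_comparison_test) (auto simp: e_def intro: order_trans[OF norm_triangle_ineq4])
    show "g \<in> borel_measurable (cube d)"
      unfolding g_def lattice_approx_def using fm
      by (intro borel_measurable_diff borel_measurable_sum borel_measurable_times borel_measurable_const measurable_ebasis)
    fix x assume x: "x \<in> space (cube d)"
    have "(\<lambda>h. c h * ebasis d h x) summable_on ?X"
      by (rule abs_summable_summable) (use c in \<open>simp add: norm_mult\<close>)
    then have 1: "((\<lambda>h. c h * ebasis d h x) has_sum f x) ?X"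
      unfolding series[OF x] by (rule has_sum_infsum)
    have 2: "((\<lambda>h. (if h \<in> ?A then fhat_a n d z f h else 0) * ebasis d h x) has_sum
        lattice_approx n d \<alpha> \<gamma> M z f x) ?X"
      unfolding lattice_approx_def by (rule has_sum_finite_neutralI[OF finA AX]) auto
    have "((\<lambda>h. c h * ebasis d h x - (if h \<in> ?A then fhat_a n d z f h else 0) * ebasis d h x) has_sum g x) ?X"
      using has_sum_add[OF 1 has_sum_cmult_right[OF 2, of "- 1"]] by (simp add: g_def)
    then show "g x = (\<Sum>\<^sub>\<infinity>h\<in>?X. e h * ebasis d h x)"
      by (simp add: e_def left_diff_distrib infsumI)
  qed
  have "(L2norm d g)\<^sup>2 = (LINT x|cube d. (cmod (g x))\<^sup>2)"
    by (simp add: L2norm_def)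
  also have "\<dots> \<le> 1 / M * infsum (\<lambda>h. (cmod (c h))\<^sup>2 * rfun \<alpha> \<gamma> h) ?X + M * infsum (\<lambda>h. q h * Q h) ?X"
    by (rule has_sum_mono[OF pars _ point])
       (intro has_sum_add has_sum_cmult_right has_sum_infsum normsum summqQ)
  also have "\<dots> \<le> 1 / M * 1 + M * Sfun n d \<alpha> \<gamma> z"
    unfolding S_eq using norm1 M by (intro add_mono mult_left_mono) auto
  finally show ?thesis by (simp add: g_def)
qed

section \<open>Worst-case error and final estimates\<close>

lemma zero_in_korobov_ball: "(\<lambda>_. 0) \<in> korobov_ball d \<alpha> \<gamma>"
  by (simp add: korobov_ball_def korobov_def fhat_def)

lemma wce_app_le:
  fixes n d :: nat and \<alpha> M :: real
  assumes "n > 0" "\<alpha> > 1" "\<And>u. finite u \<Longrightarrow> \<gamma> u > 0" "M > 0"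
  shows "wce_app n d \<alpha> \<gamma> M z \<le> sqrt (1 / M + M * Sfun n d \<alpha> \<gamma> z)"
  unfolding wce_app_def
proof (rule cSUP_least)
  show "korobov_ball d \<alpha> \<gamma> \<noteq> {}" using zero_in_korobov_ball by blast
  show "L2norm d (\<lambda>x. f x - lattice_approx n d \<alpha> \<gamma> M z f x) \<le> sqrt (1 / M + M * Sfun n d \<alpha> \<gamma> z)"
    if "f \<in> korobov_ball d \<alpha> \<gamma>" for f
    using assms that by (intro real_le_rsqrt L2norm_error_squared_le)
qed

text \<open>With this truncation level both \<open>1 / M\<close> and \<open>M * S\<close> equal
  \<open>S powr (1/2)\<close>.\<close>

lemma wce_app_le_root_Sfun:
  fixes n d :: nat and \<alpha> :: real and \<gamma> :: "nat set \<Rightarrow> real" and z :: "nat \<Rightarrow> nat"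
  assumes "n \<ge> 2" "d \<ge> 1" "\<alpha> > 1" "\<And>u. finite u \<Longrightarrow> \<gamma> u > 0"
  defines "S \<equiv> Sfun n d \<alpha> \<gamma> z"
  shows "wce_app n d \<alpha> \<gamma> (S powr (-1/2)) z \<le> sqrt 2 * S powr (1/4)"
proof -
  have S: "S > 0" unfolding S_def using assms by (intro Sfun_pos) auto
  have "wce_app n d \<alpha> \<gamma> (S powr (-1/2)) z \<le> sqrt (1 / S powr (-1/2) + S powr (-1/2) * S)"
    unfolding S_def using assms S by (intro wce_app_le) (auto simp: S_def)
  also have "1 / S powr (-1/2) + S powr (-1/2) * S = 2 * S powr (1/2)"
  proof -
    have "S powr (-1/2) * S = S powr (-1/2) * S powr 1" using S by simp
    also have "\<dots> = S powr (1/2)" by (simp only: powr_add[symmetric]) simp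
    finally show ?thesis using powr_minus_divide[of S "-1/2"] by simp
  qed
  also have "sqrt (2 * S powr (1/2)) = sqrt 2 * S powr (1/4)"
    using S by (simp add: real_sqrt_mult powr_half_sqrt[symmetric] powr_powr)
  finally show ?thesis .
qed

lemma root_Sfun_le:
  fixes n d :: nat and \<alpha> t :: real
  assumes "n \<ge> 2" "\<alpha> > 1" "\<And>u. finite u \<Longrightarrow> \<gamma> u > 0" "is_CBC n d \<alpha> \<gamma> z" "1 / \<alpha> < t" "t \<le> 1"
  shows "Sfun n d \<alpha> \<gamma> z powr (1/4) \<le>
    (2 powr (2 * \<alpha> * t + 1) + 1) powr (1 / (4 * t)) / real (totient n) powr (1 / (4 * t)) *
    (\<Sum>u\<in>Pow {1..d}. real (max (card u) 1) * \<gamma> u powr t * (2 * zeta (\<alpha> * t)) ^ card u) powr (1 / (2 * t))"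
proof -
  define \<kappa> where "\<kappa> = (2::real) powr (2 * \<alpha> * t + 1) + 1"
  define C where "C = (\<Sum>u\<in>Pow {1..d}. real (max (card u) 1) * \<gamma> u powr t * (2 * zeta (\<alpha> * t)) ^ card u)"
  have t0: "0 < t" using assms(2,5) by (meson less_trans zero_less_divide_1_iff zero_less_one)
  have "Sfun n d \<alpha> \<gamma> z powr (1/4) = (Sfun n d \<alpha> \<gamma> z powr t) powr (1 / (4 * t))"
    using t0 by (simp add: powr_powr)
  also have "\<dots> \<le> (\<kappa> / real (totient n) * C\<^sup>2) powr (1 / (4 * t))"
    unfolding \<kappa>_def C_def using assms t0 by (intro powr_mono2 Sfun_powr_le) auto
  also have "\<dots> = \<kappa> powr (1 / (4 * t)) / real (totient n) powr (1 / (4 * t)) * C powr (1 / (2 * t))"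
  proof -
    have "(C\<^sup>2) powr (1 / (4 * t)) = C powr (1 / (4 * t) + 1 / (4 * t))"
      by (simp only: power2_eq_square powr_mult powr_add)
    then show ?thesis by (simp add: powr_mult powr_divide)
  qed
  finally show ?thesis by (simp add: \<kappa>_def C_def)
qed

theorem theorem2:
  fixes n d :: nat and \<alpha> :: real and \<gamma> :: "nat set \<Rightarrow> real" and z :: "nat \<Rightarrow> nat"
  assumes "n \<ge> 2" and "d \<ge> 1" and "\<alpha> > 1"
    and "\<And>u. finite u \<Longrightarrow> \<gamma> u > 0" and "\<gamma> {} = 1"
    and "is_CBC n d \<alpha> \<gamma> z"
  shows "(\<forall>lam. 1 / \<alpha> < lam \<and> lam \<le> 1 \<longrightarrow>
            (let S = Sfun n d \<alpha> \<gamma> z; M = S powr (-1/2) in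
              wce_app n d \<alpha> \<gamma> M z \<le> sqrt 2 * S powr (1/4) \<and>
              sqrt 2 * S powr (1/4) \<le>
                sqrt 2 * (2 powr (2 * \<alpha> * lam + 1) + 1) powr (1 / (4 * lam))
                  / real (totient n) powr (1 / (4 * lam)) *
                (\<Sum>u\<in>Pow {1..d}. real (max (card u) 1) * \<gamma> u powr lam * (2 * zeta (\<alpha> * lam)) ^ card u)
                  powr (1 / (2 * lam))))
       \<and> (\<forall>\<delta>>0. 1 / \<alpha> < 1 / (\<alpha> - 4 * \<delta>) \<and> 1 / (\<alpha> - 4 * \<delta>) \<le> 1 \<and>
            (\<lambda>u. \<gamma> u powr (1 / (\<alpha> - 4 * \<delta>)) *
                  (2 * exp (1 / exp 1) * zeta (\<alpha> / (\<alpha> - 4 * \<delta>))) ^ card u)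
              summable_on {u. finite u \<and> u \<subseteq> {1..}}
            \<longrightarrow> (\<exists>C. \<forall>d'. err_const d' \<alpha> \<gamma> (1 / (\<alpha> - 4 * \<delta>)) \<le> C))"
proof (intro conjI allI impI)
  fix lam :: real
  assume lam: "1 / \<alpha> < lam \<and> lam \<le> 1"
  show "let S = Sfun n d \<alpha> \<gamma> z; M = S powr (-1/2) in
              wce_app n d \<alpha> \<gamma> M z \<le> sqrt 2 * S powr (1/4) \<and>
              sqrt 2 * S powr (1/4) \<le>
                sqrt 2 * (2 powr (2 * \<alpha> * lam + 1) + 1) powr (1 / (4 * lam))
                  / real (totient n) powr (1 / (4 * lam)) *
                (\<Sum>u\<in>Pow {1..d}. real (max (card u) 1) * \<gamma> u powr lam * (2 * zeta (\<alpha> * lam)) ^ card u)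
                  powr (1 / (2 * lam))"
    using wce_app_le_root_Sfun[OF assms(1-4)] root_Sfun_le[OF assms(1,3,4,6), of lam] lam
    by (simp add: Let_def mult.assoc flip: times_divide_eq_right)
next
  fix \<delta> :: real
  assume \<delta>: "\<delta> > 0" and A: "1 / \<alpha> < 1 / (\<alpha> - 4 * \<delta>) \<and> 1 / (\<alpha> - 4 * \<delta>) \<le> 1 \<and>
            (\<lambda>u. \<gamma> u powr (1 / (\<alpha> - 4 * \<delta>)) *
                  (2 * exp (1 / exp 1) * zeta (\<alpha> / (\<alpha> - 4 * \<delta>))) ^ card u)
              summable_on {u. finite u \<and> u \<subseteq> {1..}}"
  \<comment> \<open>The bounds assumed on \<open>1 / (\<alpha> - 4 * \<delta>)\<close> make it
    positive and its product with \<open>\<alpha>\<close> greater than 1, so the zeta series in the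
    constant converges.\<close>
  have "0 < 1 / (\<alpha> - 4 * \<delta>)" using A assms(3) by (meson less_trans zero_less_divide_1_iff zero_less_one)
  moreover have "\<alpha> * (1 / (\<alpha> - 4 * \<delta>)) > 1" using A assms(3) by (simp add: field_simps)
  ultimately show "\<exists>C. \<forall>d'. err_const d' \<alpha> \<gamma> (1 / (\<alpha> - 4 * \<delta>)) \<le> C"
    using A by (intro err_const_bounded) simp_all
qed

end
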